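(* Apart from a set of Lebesgue measure $0$, the map $\mathcal{R}:[0,1]^2\to[0,1]^2$ given by $$\mathcal{R}(x,y)=\begin{cases}\left(\frac{x}{1-2x},\frac{y}{1+2y}\right), & x\in[0,\tfrac13],\\ \left(\frac1x-2,\frac{1}{y+2}\right), & x\in[\tfrac13,\tfrac12],\\ \left(2-\frac1x,\frac{1}{2-y}\right), & x\in[\tfrac12,1],\end{cases}$$ is bijective. The absolutely continuous invariant measure $\bar\mu$ of $\mathcal{R}$ on $[0,1]^2$ is given by $$\bar\mu(D)=\int_D\frac{1}{(x+y-2xy)^2}\,\mathrm{d}(\lambda\times\lambda)$$ for every Borel set $D\subseteq[0,1]^2$, and $\mathcal{R}$ is ergodic with respect to $\bar\mu$. The map $\mathcal{R}$ is the natural extension of the Romik map $R$.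
   Context: $\lambda$ is Lebesgue measure on $[0,1]$. The Romik map $R:[0,1]\to[0,1]$ is defined by $R(x)=\frac{x}{1-2x}$ for $0\le x\le \frac13$, $R(x)=\frac1x-2$ for $\frac13\le x\le\frac12$, and $R(x)=2-\frac1x$ for $\frac12\le x\le 1$; it is considered with its $\sigma$-finite, infinite invariant measure $\mu(A)=\int_A\frac{1}{x(1-x)}\,\mathrm{d}\lambda(x)$ for Borel sets $A\subseteq[0,1]$. The values of $\mathcal{R}$ on the lines $x=\frac13$ and $x=\frac12$ (where two formulas overlap) are immaterial, since these lines are $\lambda\times\lambda$-null sets. Absolute continuity is with respect to $\lambda\times\lambda$. Ergodic means: every measurable set $D$ with $\mathcal{R}^{-1}(D)=D$ satisfies $\bar\mu(D)=0$ or $\bar\mu([0,1]^2\setminus D)=0$. "Natural extension" of $([0,1],\mu,R)$ is used in the following sense: an almost surely bijective measure-preserving system which has the original system as a factor (here via the projection $(x,y)\mapsto x$, which carries $\bar\mu$ to $\mu$). *)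

theory Defs
  imports "HOL-Analysis.Analysis"
begin

section \<open>Measure-preserving systems\<close>

definition measure_preserving :: "'a measure \<Rightarrow> 'b measure \<Rightarrow> ('a \<Rightarrow> 'b) \<Rightarrow> bool" where
  "measure_preserving M N f \<longleftrightarrow>
     f \<in> measurable M N \<and> (\<forall>A\<in>sets N. emeasure M (f -` A \<inter> space M) = emeasure N A)"

definition measure_preserving_system :: "'a measure \<Rightarrow> ('a \<Rightarrow> 'a) \<Rightarrow> bool" where
  "measure_preserving_system M T \<longleftrightarrow> sigma_finite_measure M \<and> measure_preserving M M T"

definition ergodic :: "'a measure \<Rightarrow> ('a \<Rightarrow> 'a) \<Rightarrow> bool" where
  "ergodic M T \<longleftrightarrow>
     (\<forall>D\<in>sets M. T -` D \<inter> space M = D \<longrightarrow> emeasure M D = 0 \<or> emeasure M (space M - D) = 0)"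

text \<open>The same null set is removed from the domain and from the codomain, so that the map can be
  iterated, forwards and backwards, on what remains.\<close>

definition ae_bijective :: "'a measure \<Rightarrow> ('a \<Rightarrow> 'a) \<Rightarrow> bool" where
  "ae_bijective M T \<longleftrightarrow> (\<exists>N\<in>null_sets M. bij_betw T (space M - N) (space M - N))"

definition factor_map :: "'a measure \<Rightarrow> ('a \<Rightarrow> 'a) \<Rightarrow> 'b measure \<Rightarrow> ('b \<Rightarrow> 'b) \<Rightarrow> ('a \<Rightarrow> 'b) \<Rightarrow> bool" where
  "factor_map M T N S \<pi> \<longleftrightarrow> measure_preserving M N \<pi> \<and> (AE z in M. \<pi> (T z) = S (\<pi> z))"

text \<open>A natural extension is understood here as an almost surely bijective measure-preserving
  system having the given one as a factor; minimality among such systems is not part of the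
  notion.\<close>

definition natural_extension_via ::
  "'a measure \<Rightarrow> ('a \<Rightarrow> 'a) \<Rightarrow> 'b measure \<Rightarrow> ('b \<Rightarrow> 'b) \<Rightarrow> ('a \<Rightarrow> 'b) \<Rightarrow> bool" where
  "natural_extension_via M T N S \<pi> \<longleftrightarrow>
     measure_preserving_system M T \<and> ae_bijective M T \<and>
     measure_preserving_system N S \<and> factor_map M T N S \<pi>"


section \<open>The Romik map and its planar extension\<close>

text \<open>The branches of the Romik map agree at \<open>1/3\<close> and \<open>1/2\<close>. The branches of the planar map do
  not agree on these two vertical lines; there the branch on the left is used, which affects only a
  null set.\<close>

definition romik :: "real \<Rightarrow> real" where
  "romik x =
     (if x \<le> 1/3 then x / (1 - 2 * x)
      else if x \<le> 1/2 then 1 / x - 2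
      else 2 - 1 / x)"

fun romik_ext :: "real \<times> real \<Rightarrow> real \<times> real" where
  "romik_ext (x, y) =
     (if x \<le> 1/3 then (x / (1 - 2 * x), y / (1 + 2 * y))
      else if x \<le> 1/2 then (1 / x - 2, 1 / (y + 2))
      else (2 - 1 / x, 1 / (2 - y)))"

definition leb01 :: "real measure" where
  "leb01 = restrict_space lborel {0..1}"

definition leb01_sq :: "(real \<times> real) measure" where
  "leb01_sq = leb01 \<Otimes>\<^sub>M leb01"

text \<open>The densities below are infinite at the corners \<open>0\<close>, \<open>1\<close> and \<open>(0,0)\<close>, \<open>(1,1)\<close>, where
  division by zero makes them \<open>0\<close>; this does not change the measures.\<close>

definition romik_measure :: "real measure" where
  "romik_measure = density leb01 (\<lambda>x. ennreal (1 / (x * (1 - x))))"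

definition romik_ext_measure :: "(real \<times> real) measure" where
  "romik_ext_measure =
     density leb01_sq (\<lambda>(x, y). ennreal (1 / (x + y - 2 * x * y)\<^sup>2))"

text \<open>An infinite invariant measure is determined only up to a constant factor. Without
  \<sigma>-finiteness uniqueness fails: the measure that is \<open>\<infinity>\<close> on every set of positive Lebesgue measure
  and \<open>0\<close> on null sets is also invariant and absolutely continuous. The factor \<open>c = 0\<close> accounts for
  the zero measure.\<close>

definition is_the_acim :: "'a measure \<Rightarrow> ('a \<Rightarrow> 'a) \<Rightarrow> 'a measure \<Rightarrow> bool" where
  "is_the_acim L T M \<longleftrightarrow>
     sets M = sets L \<and> absolutely_continuous L M \<and> measure_preserving_system M T \<and>
     (\<forall>\<nu>. sets \<nu> = sets L \<and> absolutely_continuous L \<nu> \<and> measure_preserving_system \<nu> T \<longrightarrow>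
        (\<exists>c::real. c \<ge> 0 \<and> \<nu> = scale_measure (ennreal c) M))"

end

theory Submission
  imports Defs
begin

text \<open>On the set of points with two irrational coordinates the planar map is a bijection: each branch is a
Moebius map with integer coefficients in each coordinate, and exchanging the coordinates conjugates
the map to its inverse (\<open>romik_ext_swap\<close>). The three branches map vertical strips onto horizontal
ones, and the kernel \<open>1 / (x + y - 2xy)\<^sup>2\<close>, composed with a branch and multiplied by the absolute
value of its Jacobian determinant, gives the kernel back, so substituting in one coordinate at a time
shows that the measure is invariant (\<open>romik_integral_invariant\<close>). Integrating the kernel over \<open>y\<close> gives \<open>1 / (x (1 - x))\<close>, which makes
the Romik map a factor.

Ergodicity is Hopf's argument, carried out for a first-return map because the measure is infinite.
The core is the square without its two corner squares \<open>x, y < 1/3\<close> and \<open>x, y > 1/2\<close>, where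
the density is unbounded. It has finite measure, every irrational orbit enters it
(\<open>enters_romik_core\<close>), and the first-return map does not increase the measure of preimages
(\<open>first_return_map_vimage\<close>). Whether a point after at least one step lies in the core depends only on
the first coordinate of its predecessor. Two core points on the same vertical line therefore return
at the same times, while the distance between them shrinks at least by the factor \<open>4/9\<close> at each return
(\<open>core_return_contraction\<close>).
Approximating an invariant set \<open>D\<close> and its complement in the core by disjoint compact sets, two such
points on different sides of \<open>D\<close> would after many returns be closer than the distance of the compact
sets, unless one of the returns falls into the small remainder; hence almost every column of the core lies in \<open>D\<close> or in its complement up to null sets
(\<open>core_columns_dichotomy\<close>). By the symmetry the same holds for rows, and since columns over
\<open>[1/3, 1/2]\<close> are full, each row meets them in positive measure and Fubini makes \<open>D\<close> trivial in the
core, hence everywhere.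

For uniqueness, the density of another invariant measure with respect to the given one is an
invariant function because the map is invertible almost everywhere; it is constant by ergodicity, and
finite by \<open>\<sigma>\<close>-finiteness.\<close>

section \<open>Measure-preserving maps: first returns and invariant functions\<close>

lemma measure_preservingD:
  assumes "measure_preserving M N f"
  shows "f \<in> measurable M N" "A \<in> sets N \<Longrightarrow> emeasure M (f -` A \<inter> space M) = emeasure N A"
  using assms by (auto simp: measure_preserving_def)

lemma AE_measure_preserving:
  assumes "measure_preserving M N f" "AE z in N. P z"
  shows "AE z in M. P (f z)"
proof -
  note [measurable] = measure_preservingD(1)[OF assms(1)]
  obtain K where K: "{z\<in>space N. \<not> P z} \<subseteq> K" "emeasure N K = 0" "K \<in> sets N"
    using assms(2) by (rule AE_E)
  show ?thesis
  proof (rule AE_I)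
    show "{z\<in>space M. \<not> P (f z)} \<subseteq> f -` K \<inter> space M"
      using K(1) measurable_space[OF measure_preservingD(1)[OF assms(1)]] by auto
    show "emeasure M (f -` K \<inter> space M) = 0"
      using K(2) measure_preservingD(2)[OF assms(1) K(3)] by simp
    show "f -` K \<inter> space M \<in> sets M"
      using K(3) by measurable
  qed
qed

lemma factor_measure_preserving:
  assumes T: "measure_preserving M M T" and p: "measure_preserving M N p"
    and S: "S \<in> measurable N N" and comm: "\<And>z. z \<in> space M \<Longrightarrow> p (T z) = S (p z)"
  shows "measure_preserving N N S"
  unfolding measure_preserving_def
proof (intro conjI ballI)
  fix A assume A: "A \<in> sets N"
  have SA: "S -` A \<inter> space N \<in> sets N" using S A by (rule measurable_sets)
  have pA: "p -` A \<inter> space M \<in> sets M" using measure_preservingD(1)[OF p] A by (rule measurable_sets)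
  have "emeasure N (S -` A \<inter> space N) = emeasure M (p -` (S -` A \<inter> space N) \<inter> space M)"
    using measure_preservingD(2)[OF p SA] by simp
  also have "p -` (S -` A \<inter> space N) \<inter> space M = T -` (p -` A \<inter> space M) \<inter> space M"
    using comm measurable_space[OF measure_preservingD(1)[OF p]] measurable_space[OF measure_preservingD(1)[OF T]]
    by auto
  also have "emeasure M \<dots> = emeasure N A"
    using measure_preservingD(2)[OF T pA] measure_preservingD(2)[OF p A] by simp
  finally show "emeasure N (S -` A \<inter> space N) = emeasure N A" .
qed (fact S)

text \<open>The first-return map to \<open>E\<close>: the first point of the orbit of \<open>T z\<close> that lies in \<open>E\<close>. If there is none,
\<^const>\<open>Least\<close> has an unspecified value, so the lemmas on preimages assume that points of \<open>E\<close> return.\<close>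

definition first_return_map :: "('a \<Rightarrow> 'a) \<Rightarrow> 'a set \<Rightarrow> 'a \<Rightarrow> 'a" where
  "first_return_map T E z = (T ^^ (LEAST k. (T ^^ k) (T z) \<in> E)) (T z)"

lemma first_return_map_in:
  assumes "\<exists>k. (T ^^ k) (T z) \<in> E"
  shows "first_return_map T E z \<in> E"
  using LeastI_ex[OF assms] by (simp add: first_return_map_def)

lemma first_return_map_eqI:
  assumes "(T ^^ k) (T z) \<in> E" "\<And>j. j < k \<Longrightarrow> (T ^^ j) (T z) \<notin> E"
  shows "first_return_map T E z = (T ^^ k) (T z)"
proof -
  have "(LEAST k. (T ^^ k) (T z) \<in> E) = k"
    using assms by (intro Least_equality) (auto simp: not_less[symmetric])
  thus ?thesis by (simp add: first_return_map_def)
qed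

text \<open>No invertibility or recurrence outside \<open>E\<close> is needed for this inequality. Let \<open>F k\<close> be the set of points
whose first visit to \<open>E\<close> is at time \<open>k\<close> and takes place in \<open>B\<close>. Then \<open>F 0 = B\<close>, and the preimage of
\<open>F k\<close> is the disjoint union of \<open>F (k + 1)\<close> and of the points of \<open>E\<close> that return after \<open>k + 1\<close> steps
into \<open>B\<close>; summing over \<open>k\<close> telescopes.\<close>

lemma first_return_map_vimage:
  assumes mp: "measure_preserving M M T" and E[measurable]: "E \<in> sets M"
    and B[measurable]: "B \<in> sets M" and BE: "B \<subseteq> E"
    and ret: "\<And>z. z \<in> E \<Longrightarrow> \<exists>k. (T ^^ k) (T z) \<in> E"
  shows "{z\<in>E. first_return_map T E z \<in> B} \<in> sets M"
    and "emeasure M {z\<in>E. first_return_map T E z \<in> B} \<le> emeasure M B"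
proof -
  note T[measurable] = measure_preservingD(1)[OF mp]
  have Tk[measurable]: "(T ^^ k) \<in> measurable M M" for k
    by (rule measurable_compose_n) (rule T)
  define F where "F k = {w\<in>space M. (T ^^ k) w \<in> B \<and> (\<forall>j<k. (T ^^ j) w \<notin> E)}" for k
  have F[measurable]: "F k \<in> sets M" for k
    unfolding F_def by measurable
  define G where "G k = E \<inter> (T -` F k \<inter> space M)" for k
  have G[measurable]: "G k \<in> sets M" for k
    unfolding G_def by measurable
  have F0: "F 0 = B"
    using sets.sets_into_space[OF B] by (auto simp: F_def)
  have FS: "F (Suc k) = (T -` F k \<inter> space M) - E" for k
    using measurable_space[OF T]
    by (auto simp: F_def funpow_Suc_right All_less_Suc2 simp del: funpow.simps(2))
  have step: "emeasure M (F k) = emeasure M (G k) + emeasure M (F (Suc k))" for k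
  proof -
    have "emeasure M (F k) = emeasure M (T -` F k \<inter> space M)"
      using measure_preservingD(2)[OF mp F] by simp
    also have "T -` F k \<inter> space M = G k \<union> F (Suc k)"
      by (auto simp: G_def FS)
    also have "emeasure M \<dots> = emeasure M (G k) + emeasure M (F (Suc k))"
      by (rule plus_emeasure[symmetric]) (auto simp: G_def FS)
    finally show ?thesis .
  qed
  have "(\<Sum>k<n. emeasure M (G k)) + emeasure M (F n) = emeasure M B" for n
  proof (induction n)
    case (Suc n)
    thus ?case using step[of n] by (simp add: add.assoc)
  qed (simp add: F0)
  hence sum_le: "(\<Sum>k<n. emeasure M (G k)) \<le> emeasure M B" for n
    by (metis le_iff_add)
  have un: "{z\<in>E. first_return_map T E z \<in> B} = (\<Union>k. G k)"
  proof (intro equalityI subsetI)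
    fix z assume z: "z \<in> {z\<in>E. first_return_map T E z \<in> B}"
    define k where "k = (LEAST k. (T ^^ k) (T z) \<in> E)"
    have "z \<in> space M"
      using z sets.sets_into_space[OF E] by auto
    have "T z \<in> F k"
      using z measurable_space[OF T \<open>z \<in> space M\<close>]
      by (auto simp: F_def k_def first_return_map_def dest: not_less_Least)
    thus "z \<in> (\<Union>k. G k)"
      using z \<open>z \<in> space M\<close> by (auto simp: G_def)
  next
    fix z assume "z \<in> (\<Union>k. G k)"
    then obtain k where k: "z \<in> E" "T z \<in> F k" by (auto simp: G_def)
    hence "first_return_map T E z = (T ^^ k) (T z)"
      using BE by (intro first_return_map_eqI) (auto simp: F_def)
    thus "z \<in> {z\<in>E. first_return_map T E z \<in> B}"
      using k by (auto simp: F_def)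
  qed
  show "{z\<in>E. first_return_map T E z \<in> B} \<in> sets M"
    unfolding un by measurable
  have "emeasure M (\<Union>k. G k) \<le> (\<Sum>k. emeasure M (G k))"
    by (rule emeasure_subadditive_countably) auto
  also have "\<dots> \<le> emeasure M B"
    by (rule suminf_le_const) (use sum_le in auto)
  finally show "emeasure M {z\<in>E. first_return_map T E z \<in> B} \<le> emeasure M B"
    unfolding un .
qed

lemma first_return_map_funpow_vimage:
  assumes mp: "measure_preserving M M T" and E: "E \<in> sets M"
    and B: "B \<in> sets M" "B \<subseteq> E"
    and ret: "\<And>z. z \<in> E \<Longrightarrow> \<exists>k. (T ^^ k) (T z) \<in> E"
  shows "{z\<in>E. (first_return_map T E ^^ n) z \<in> B} \<in> sets M \<and>
    emeasure M {z\<in>E. (first_return_map T E ^^ n) z \<in> B} \<le> emeasure M B"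
proof (induction n)
  case 0
  have "{z \<in> E. z \<in> B} = B" using B by auto
  thus ?case using B by simp
next
  case (Suc n)
  let ?C = "{z\<in>E. (first_return_map T E ^^ n) z \<in> B}"
  have eq: "{z\<in>E. (first_return_map T E ^^ Suc n) z \<in> B} = {z\<in>E. first_return_map T E z \<in> ?C}"
    using first_return_map_in[OF ret] by (auto simp: funpow_Suc_right simp del: funpow.simps(2))
  show ?case
    unfolding eq using Suc first_return_map_vimage[OF mp E _ _ ret, of ?C] by (auto intro: order_trans)
qed

text \<open>An almost everywhere invariant set agrees up to a null set with the set of points that visit it
infinitely often, which is invariant without exceptions.\<close>

lemma strictly_invariant_version:
  assumes mp: "measure_preserving M M T" and D[measurable]: "D \<in> sets M"
    and inv: "AE z in M. T z \<in> D \<longleftrightarrow> z \<in> D"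
  obtains D' where "D' \<in> sets M" "T -` D' \<inter> space M = D'" "AE z in M. z \<in> D' \<longleftrightarrow> z \<in> D"
proof -
  note T[measurable] = measure_preservingD(1)[OF mp]
  have Tk[measurable]: "(T ^^ k) \<in> measurable M M" for k
    by (rule measurable_compose_n) (rule T)
  define D' where "D' = {z\<in>space M. \<exists>\<^sub>\<infinity>n. (T ^^ n) z \<in> D}"
  have "D' \<in> sets M"
    unfolding D'_def INFM_nat by measurable
  moreover have "T -` D' \<inter> space M = D'"
  proof -
    have "(\<exists>\<^sub>\<infinity>n. (T ^^ n) (T z) \<in> D) \<longleftrightarrow> (\<exists>\<^sub>\<infinity>n. (T ^^ n) z \<in> D)" for z
    proof -
      have "(\<exists>\<^sub>\<infinity>n. (T ^^ n) (T z) \<in> D) \<longleftrightarrow> (\<exists>\<^sub>\<infinity>n. (T ^^ Suc n) z \<in> D)"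
        by (simp add: funpow_Suc_right del: funpow.simps(2))
      also have "\<dots> \<longleftrightarrow> (\<exists>\<^sub>\<infinity>n. (T ^^ n) z \<in> D)"
        unfolding frequently_cofinite using MOST_Suc_iff[of "\<lambda>n. (T ^^ n) z \<notin> D"]
        by (simp add: eventually_cofinite)
      finally show ?thesis .
    qed
    thus ?thesis using measurable_space[OF T] by (auto simp: D'_def)
  qed
  moreover have "AE z in M. z \<in> D' \<longleftrightarrow> z \<in> D"
  proof -
    have "AE z in M. (T ^^ n) z \<in> D \<longleftrightarrow> z \<in> D" for n
    proof (induction n)
      case (Suc n)
      have "AE z in M. (T ^^ n) (T z) \<in> D \<longleftrightarrow> T z \<in> D"
        by (rule AE_measure_preserving[OF mp Suc])
      with inv show ?case
        by eventually_elim (simp add: funpow_Suc_right del: funpow.simps(2))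
    qed simp
    hence "AE z in M. \<forall>n. (T ^^ n) z \<in> D \<longleftrightarrow> z \<in> D"
      by (simp add: AE_all_countable)
    with AE_space show ?thesis
      by eventually_elim (auto simp: D'_def)
  qed
  ultimately show thesis by (rule that)
qed

lemma ergodic_invariant_function_constant:
  fixes h :: "'a \<Rightarrow> 'b::{second_countable_topology, dense_linorder, linorder_topology}"
  assumes mp: "measure_preserving M M T" and erg: "ergodic M T"
    and h[measurable]: "h \<in> borel_measurable M" and inv: "AE z in M. h (T z) = h z"
  shows "\<exists>c. AE z in M. h z = c"
proof -
  obtain Q :: "'b set" where Q: "countable Q" "\<And>X. open X \<Longrightarrow> X \<noteq> {} \<Longrightarrow> \<exists>q\<in>Q. q \<in> X"
    by (rule countable_dense_setE) blast
  have dich: "\<exists>P. AE z in M. (h z < q) = P" for q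
  proof -
    let ?D = "{z\<in>space M. h z < q}"
    have T: "T \<in> measurable M M" using mp by (rule measure_preservingD)
    have "AE z in M. T z \<in> ?D \<longleftrightarrow> z \<in> ?D"
      using inv AE_space by eventually_elim (use measurable_space[OF T] in auto)
    from strictly_invariant_version[OF mp _ this]
    obtain D' where D': "D' \<in> sets M" "T -` D' \<inter> space M = D'"
      "AE z in M. z \<in> D' \<longleftrightarrow> z \<in> ?D" by auto
    have "emeasure M D' = 0 \<or> emeasure M (space M - D') = 0"
      using erg D' by (auto simp: ergodic_def)
    thus ?thesis
    proof
      assume "emeasure M D' = 0"
      hence "AE z in M. z \<notin> D'" using D' by (intro AE_not_in) auto
      with D'(3) AE_space have "AE z in M. (h z < q) = False" by eventually_elim auto
      thus ?thesis ..
    next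
      assume "emeasure M (space M - D') = 0"
      hence "AE z in M. z \<notin> space M - D'" using D' by (intro AE_not_in) auto
      with D'(3) AE_space have "AE z in M. (h z < q) = True" by eventually_elim auto
      thus ?thesis ..
    qed
  qed
  then obtain P where "\<And>q. AE z in M. (h z < q) = P q" by metis
  hence AE: "AE z in M. \<forall>q\<in>Q. (h z < q) = P q"
    using Q(1) by (simp add: AE_ball_countable)
  show ?thesis
  proof (cases "\<exists>z0. \<forall>q\<in>Q. (h z0 < q) = P q")
    case False
    have "AE z in M. h z = undefined"
      using AE by eventually_elim (use False in blast)
    thus ?thesis ..
  next
    case True
    then obtain z0 where z0: "\<forall>q\<in>Q. (h z0 < q) = P q" ..
    \<comment> \<open>Elements of \<open>Q\<close> separate points, so the truth values \<open>h z < q\<close> determine \<open>h z\<close>.\<close>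
    have "\<exists>q\<in>Q. a < q \<and> q \<le> b" if "a < b" for a b
      using Q(2)[of "{a<..<b}"] dense[OF that] by fastforce
    hence "h z = h z0" if "\<forall>q\<in>Q. (h z < q) = P q" for z
      using that z0 by (metis linorder_neq_iff not_less)
    with AE have "AE z in M. h z = h z0" by auto
    thus ?thesis ..
  qed
qed


section \<open>The planar map on the irrational square\<close>

text \<open>The points of the open unit square with two irrational coordinates: a set of full measure, invariant
under the planar map and its inverse, that avoids the lines on which branches meet.\<close>

definition irrational_square :: "(real \<times> real) set" where
  "irrational_square = {(x, y). 0 < x \<and> x < 1 \<and> 0 < y \<and> y < 1 \<and> x \<notin> \<rat> \<and> y \<notin> \<rat>}"

lemma mem_irrational_square [simp]:
  "(x, y) \<in> irrational_square \<longleftrightarrow> 0 < x \<and> x < 1 \<and> 0 < y \<and> y < 1 \<and> x \<notin> \<rat> \<and> y \<notin> \<rat>"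
  by (simp add: irrational_square_def)

lemma swap_mem_irrational_square [simp]:
  "prod.swap z \<in> irrational_square \<longleftrightarrow> z \<in> irrational_square"
  by (cases z) auto

lemma irrational_ne:
  fixes x :: real
  assumes "x \<notin> \<rat>"
  shows "x \<noteq> 1/3" "x \<noteq> 1/2"
proof -
  have "(1/3::real) \<in> \<rat>" "(1/2::real) \<in> \<rat>" by (intro Rats_divide; simp)+
  thus "x \<noteq> 1/3" "x \<noteq> 1/2" using assms by metis+
qed

lemma Rats_moebius:
  fixes x :: real
  assumes "x \<notin> \<rat>" "x \<in> {0..1}"
  shows "x / (1 - 2 * x) \<notin> \<rat>" "x / (1 + 2 * x) \<notin> \<rat>" "1 / x - 2 \<notin> \<rat>" "1 / (x + 2) \<notin> \<rat>"
    "2 - 1 / x \<notin> \<rat>" "1 / (2 - x) \<notin> \<rat>"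
proof -
  have x: "x \<noteq> 0" "x \<noteq> 1" using assms by auto
  have x': "1 - 2 * x \<noteq> 0" using irrational_ne[of x] assms by auto
  have *: "f x \<notin> \<rat>" if "x = g (f x)" "\<And>r. r \<in> \<rat> \<Longrightarrow> g r \<in> \<rat>" for f g :: "real \<Rightarrow> real"
    using that assms by metis
  show "x / (1 - 2 * x) \<notin> \<rat>"
    by (rule *[of "\<lambda>r. r / (1 + 2 * r)"]) (use assms x x' in \<open>auto simp: divide_simps\<close>)
  show "x / (1 + 2 * x) \<notin> \<rat>"
    by (rule *[of "\<lambda>r. r / (1 - 2 * r)"]) (use assms x x' in \<open>auto simp: divide_simps\<close>)
  show "1 / x - 2 \<notin> \<rat>"
    by (rule *[of "\<lambda>r. 1 / (r + 2)"]) (use assms x x' in \<open>auto simp: divide_simps\<close>)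
  show "1 / (x + 2) \<notin> \<rat>"
    by (rule *[of "\<lambda>r. 1 / r - 2"]) (use assms x x' in \<open>auto simp: divide_simps\<close>)
  show "2 - 1 / x \<notin> \<rat>"
    by (rule *[of "\<lambda>r. 1 / (2 - r)"]) (use assms x x' in \<open>auto simp: divide_simps\<close>)
  show "1 / (2 - x) \<notin> \<rat>"
    by (rule *[of "\<lambda>r. 2 - 1 / r"]) (use assms x x' in \<open>auto simp: divide_simps\<close>)
qed

lemma romik_ext_irrational_square:
  assumes "z \<in> irrational_square"
  shows "romik_ext z \<in> irrational_square"
proof -
  obtain x y where z: "z = (x, y)" by (cases z)
  have *: "0 < x" "x < 1" "0 < y" "y < 1" "x \<noteq> 1/3" "x \<noteq> 1/2"
    using assms irrational_ne[of x] by (auto simp: z)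
  have rat: "x / (1 - 2 * x) \<notin> \<rat>" "y / (1 + 2 * y) \<notin> \<rat>" "1 / x - 2 \<notin> \<rat>" "1 / (y + 2) \<notin> \<rat>"
    "2 - 1 / x \<notin> \<rat>" "1 / (2 - y) \<notin> \<rat>"
    using assms Rats_moebius[of x] Rats_moebius[of y] by (auto simp: z)
  consider "x < 1/3" | "1/3 < x" "x < 1/2" | "1/2 < x" using * by linarith
  thus ?thesis
  proof cases
    case 1
    hence "0 < x / (1 - 2 * x)" "x / (1 - 2 * x) < 1" "0 < y / (1 + 2 * y)" "y / (1 + 2 * y) < 1"
      using * by (simp_all add: field_simps)
    thus ?thesis using 1 rat by (simp add: z)
  next
    case 2
    hence "0 < 1 / x - 2" "1 / x - 2 < 1" "0 < 1 / (y + 2)" "1 / (y + 2) < 1"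
      using * by (simp_all add: field_simps)
    thus ?thesis using 2 rat by (simp add: z)
  next
    case 3
    hence "0 < 2 - 1 / x" "2 - 1 / x < 1" "0 < 1 / (2 - y)" "1 / (2 - y) < 1"
      using * by (simp_all add: field_simps)
    thus ?thesis using 3 rat by (simp add: z)
  qed
qed

text \<open>The exchange of coordinates conjugates the planar map to its inverse; this symmetry also transfers
statements about columns to rows.\<close>

lemma romik_ext_swap:
  assumes "z \<in> irrational_square"
  shows "romik_ext (prod.swap (romik_ext (prod.swap z))) = z"
proof -
  obtain x y where z: "z = (x, y)" by (cases z)
  have *: "0 < x" "x < 1" "0 < y" "y < 1" "y \<noteq> 1/3" "y \<noteq> 1/2"
    using assms irrational_ne[of y] by (auto simp: z)
  consider "y < 1/3" | "1/3 < y" "y < 1/2" | "1/2 < y" using * by linarith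
  thus ?thesis
  proof cases
    case 1
    thus ?thesis using * by (simp add: z field_simps)
  next
    case 2
    thus ?thesis using * by (simp add: z field_simps)
  next
    case 3
    thus ?thesis using * by (simp add: z field_simps)
  qed
qed

text \<open>The inverse of the planar map on the irrational square.\<close>

definition romik_ext_inv :: "real \<times> real \<Rightarrow> real \<times> real" where
  "romik_ext_inv z = prod.swap (romik_ext (prod.swap z))"

lemma romik_ext_inv_irrational_square:
  "z \<in> irrational_square \<Longrightarrow> romik_ext_inv z \<in> irrational_square"
  by (simp add: romik_ext_inv_def romik_ext_irrational_square)

lemma romik_ext_romik_ext_inv [simp]:
  "z \<in> irrational_square \<Longrightarrow> romik_ext (romik_ext_inv z) = z"
  by (simp add: romik_ext_inv_def romik_ext_swap)

lemma romik_ext_inv_romik_ext [simp]: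
  "z \<in> irrational_square \<Longrightarrow> romik_ext_inv (romik_ext z) = z"
  using romik_ext_swap[of "prod.swap z"] by (simp add: romik_ext_inv_def)

lemma bij_betw_romik_ext: "bij_betw romik_ext irrational_square irrational_square"
proof (rule bij_betw_byWitness[where f' = romik_ext_inv])
  show "romik_ext ` irrational_square \<subseteq> irrational_square"
    using romik_ext_irrational_square by blast
  show "romik_ext_inv ` irrational_square \<subseteq> irrational_square"
    using romik_ext_inv_irrational_square by blast
qed (use romik_ext_romik_ext_inv romik_ext_inv_romik_ext in blast)+

lemma fst_romik_ext: "fst (romik_ext z) = romik (fst z)"
  by (cases z) (simp add: romik_def)

lemma romik_ext_unit_square:
  assumes "z \<in> {0..1} \<times> {0..1}"
  shows "romik_ext z \<in> {0..1} \<times> {0..1}"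
  using assms by (cases z) (auto simp: field_simps)


lemma space_leb01 [simp]: "space leb01 = {0..1}"
  by (simp add: leb01_def)

lemma space_leb01_sq [simp]: "space leb01_sq = {0..1} \<times> {0..1}"
  by (simp add: leb01_sq_def space_pair_measure)

lemma sets_leb01 [measurable_cong]: "sets leb01 = sets (restrict_space borel {0..1})"
  unfolding leb01_def by (intro sets_restrict_space_cong) simp

lemma sets_leb01_iff: "A \<in> sets leb01 \<longleftrightarrow> A \<subseteq> {0..1} \<and> A \<in> sets borel"
  by (subst sets_leb01) (simp add: sets_restrict_space_iff)

lemma measurable_leb01_borel: "id \<in> measurable leb01 borel"
  by (auto intro!: measurableI simp: sets_leb01 sets_restrict_space)

lemma measurable_fst_leb01_sq [measurable]: "fst \<in> borel_measurable leb01_sq"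
  and measurable_snd_leb01_sq [measurable]: "snd \<in> borel_measurable leb01_sq"
  unfolding leb01_sq_def
  using measurable_compose[OF measurable_fst measurable_leb01_borel]
    measurable_compose[OF measurable_snd measurable_leb01_borel] by (auto simp: comp_def)

text \<open>The product \<open>\<sigma>\<close>-algebra consists of the Borel sets of the plane contained in the unit square.\<close>

lemma sets_leb01_sq: "sets leb01_sq = sets (restrict_space borel ({0..1} \<times> {0..1}))"
proof (intro equalityI subsetI)
  fix A assume A: "A \<in> sets leb01_sq"
  have "(\<lambda>z. (fst z, snd z)) \<in> measurable (restrict_space borel ({0..1} \<times> {0..1})) leb01_sq"
    unfolding leb01_sq_def leb01_def
    by (intro measurable_Pair measurable_restrict_space2 measurable_restrict_space1)
       (auto simp: borel_prod[symmetric] space_restrict_space)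
  from measurable_sets[OF this A] sets.sets_into_space[OF A]
  show "A \<in> sets (restrict_space borel ({0..1} \<times> {0..1}))"
    by (simp add: space_restrict_space Int_absorb2)
next
  fix A :: "(real \<times> real) set"
  assume A: "A \<in> sets (restrict_space borel ({0..1} \<times> {0..1}))"
  have "closed ({0..1::real} \<times> {0..1::real})" by (intro closed_Times) auto
  hence A': "A \<in> sets borel" "A \<subseteq> {0..1} \<times> {0..1}"
    using A by (auto simp: sets_restrict_space_iff)
  have "(\<lambda>z. (fst z, snd z)) \<in> measurable leb01_sq (borel \<Otimes>\<^sub>M borel)"
    by measurable
  hence "(\<lambda>z. (fst z, snd z)) \<in> borel_measurable leb01_sq"
    by (simp only: borel_prod)
  from measurable_sets[OF this A'(1)]
  have "(\<lambda>z. (fst z, snd z)) -` A \<inter> space leb01_sq \<in> sets leb01_sq" .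
  thus "A \<in> sets leb01_sq" using A'(2) by (simp add: Int_absorb2)
qed

lemma sets_leb01_sq_iff: "A \<in> sets leb01_sq \<longleftrightarrow> A \<subseteq> {0..1} \<times> {0..1} \<and> A \<in> sets borel"
proof -
  have "closed ({0..1::real} \<times> {0..1::real})" by (intro closed_Times) auto
  thus ?thesis by (subst sets_leb01_sq) (simp add: sets_restrict_space_iff)
qed

lemma sigma_finite_leb01: "sigma_finite_measure leb01"
  unfolding leb01_def by (intro sigma_finite_measure_restrict_space) (auto intro: lborel.sigma_finite_measure_axioms)

interpretation leb01: sigma_finite_measure leb01
  by (rule sigma_finite_leb01)

interpretation leb01_pair: pair_sigma_finite leb01 leb01 ..

lemma emeasure_leb01: "A \<subseteq> {0..1} \<Longrightarrow> emeasure leb01 A = emeasure lborel A"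
  unfolding leb01_def by (intro emeasure_restrict_space) auto

lemma AE_leb01_irrational: "AE x in leb01. x \<notin> \<rat>"
proof -
  have "AE x in lborel. (x::real) \<notin> \<rat>"
    by (intro AE_not_in countable_imp_null_set_lborel countable_rat)
  thus ?thesis unfolding leb01_def by (subst AE_restrict_space_iff) auto
qed

lemma borel_irrational_square [measurable]: "irrational_square \<in> sets borel"
proof -
  have [measurable]: "(\<rat> :: real set) \<in> sets borel"
    using null_setsD2[OF countable_imp_null_set_lborel[OF countable_rat]] by simp
  have "{z\<in>space (borel \<Otimes>\<^sub>M borel) :: (real \<times> real) set. 0 < fst z \<and> fst z < 1 \<and> 0 < snd z \<and> snd z < 1 \<and> fst z \<notin> \<rat> \<and> snd z \<notin> (\<rat>::real set)}
      \<in> sets (borel \<Otimes>\<^sub>M borel)"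
    by measurable
  moreover have "irrational_square = {z\<in>space (borel \<Otimes>\<^sub>M borel) :: (real \<times> real) set. 0 < fst z \<and> fst z < 1 \<and> 0 < snd z \<and> snd z < 1 \<and> fst z \<notin> \<rat> \<and> snd z \<notin> (\<rat>::real set)}"
    by (auto simp: irrational_square_def space_pair_measure)
  ultimately have "irrational_square \<in> sets (borel \<Otimes>\<^sub>M borel)" by (simp only:)
  thus ?thesis by (simp only: borel_prod)
qed

lemma irrational_square_subset: "irrational_square \<subseteq> {0..1} \<times> {0..1}"
  by (auto simp: irrational_square_def)

lemma irrational_square_sets [measurable]: "irrational_square \<in> sets leb01_sq"
  using irrational_square_subset borel_irrational_square by (simp add: sets_leb01_sq_iff)

lemma AE_irrational_square: "AE z in leb01_sq. z \<in> irrational_square"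
proof -
  have AE: "AE x in leb01. AE y in leb01. (x, y) \<in> irrational_square"
    using AE_leb01_irrational AE_space
  proof eventually_elim
    case (elim x)
    from AE_leb01_irrational AE_space show ?case
    proof eventually_elim
      case (elim y)
      have "x \<noteq> 0" "x \<noteq> 1" "y \<noteq> 0" "y \<noteq> 1" using elim \<open>x \<notin> \<rat>\<close> by auto
      thus ?case using elim \<open>x \<notin> \<rat>\<close> \<open>x \<in> space leb01\<close> by auto
    qed
  qed
  have "{z\<in>space leb01_sq. z \<in> irrational_square} \<in> sets leb01_sq"
    by measurable
  with AE show ?thesis
    unfolding leb01_sq_def by (intro leb01_pair.AE_pair_measure)
qed

lemma compl_irrational_square_null:
  "{0..1} \<times> {0..1} - irrational_square \<in> null_sets leb01_sq"
proof -
  have "{z \<in> space leb01_sq. z \<notin> irrational_square} \<in> sets leb01_sq"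
    by measurable
  hence "{z \<in> space leb01_sq. z \<notin> irrational_square} \<in> null_sets leb01_sq"
    using AE_irrational_square by (simp add: AE_iff_null)
  moreover have "{z \<in> space leb01_sq. z \<notin> irrational_square} = {0..1} \<times> {0..1} - irrational_square"
    by auto
  ultimately show ?thesis by simp
qed

lemma ae_bijective_romik_ext: "ae_bijective leb01_sq romik_ext"
  unfolding ae_bijective_def
proof (rule bexI[OF _ compl_irrational_square_null])
  have "space leb01_sq - ({0..1} \<times> {0..1} - irrational_square) = irrational_square"
    using irrational_square_subset by auto
  thus "bij_betw romik_ext (space leb01_sq - ({0..1} \<times> {0..1} - irrational_square))
    (space leb01_sq - ({0..1} \<times> {0..1} - irrational_square))"
    using bij_betw_romik_ext by simp
qed

lemma romik_ext_altdef:
  "romik_ext z =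
     (if fst z \<le> 1/3 then (fst z / (1 - 2 * fst z), snd z / (1 + 2 * snd z))
      else if fst z \<le> 1/2 then (1 / fst z - 2, 1 / (snd z + 2))
      else (2 - 1 / fst z, 1 / (2 - snd z)))"
  by (cases z) simp

lemma borel_measurable_romik_ext [measurable]: "romik_ext \<in> borel_measurable borel"
proof -
  have "romik_ext \<in> measurable (borel \<Otimes>\<^sub>M borel) (borel \<Otimes>\<^sub>M borel)"
    unfolding romik_ext_altdef[abs_def] by measurable
  thus ?thesis by (simp add: borel_prod)
qed

lemma measurable_romik_ext [measurable]: "romik_ext \<in> measurable leb01_sq leb01_sq"
proof -
  have "romik_ext \<in> measurable (restrict_space borel ({0..1} \<times> {0..1})) (restrict_space borel ({0..1} \<times> {0..1}))"
    by (intro measurable_restrict_space3) (use romik_ext_unit_square in auto)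
  thus ?thesis by (simp add: sets_leb01_sq cong: measurable_cong_sets)
qed

lemma measurable_swap [measurable]: "prod.swap \<in> measurable leb01_sq leb01_sq"
  using measurable_pair_swap'[of leb01 leb01] by (simp add: leb01_sq_def prod.swap_def[abs_def] case_prod_beta')

lemma measurable_romik_ext_inv [measurable]: "romik_ext_inv \<in> measurable leb01_sq leb01_sq"
  unfolding romik_ext_inv_def[abs_def] by measurable

lemma borel_measurable_romik [measurable]: "romik \<in> borel_measurable borel"
  unfolding romik_def[abs_def] by measurable

lemma measurable_romik [measurable]: "romik \<in> measurable leb01 leb01"
proof -
  have "romik \<in> measurable (restrict_space borel {0..1}) (restrict_space borel {0..1})"
    by (intro measurable_restrict_space3) (auto simp: romik_def field_simps)
  thus ?thesis by (simp add: sets_leb01 cong: measurable_cong_sets)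
qed


section \<open>Invariance of the measure and its projection\<close>

text \<open>The density of the invariant measure, as a function of two real arguments. On the unit
square the denominator vanishes only at the corners \<open>(0, 0)\<close> and \<open>(1, 1)\<close>, where the value is \<open>0\<close>.\<close>

definition romik_kernel :: "real \<Rightarrow> real \<Rightarrow> real" where
  "romik_kernel x y = 1 / (x + y - 2 * x * y)\<^sup>2"

lemma romik_ext_measure_altdef:
  "romik_ext_measure = density leb01_sq (\<lambda>z. ennreal (romik_kernel (fst z) (snd z)))"
  by (simp add: romik_ext_measure_def romik_kernel_def case_prod_beta')

lemma sets_romik_ext_measure [measurable_cong]: "sets romik_ext_measure = sets leb01_sq"
  by (simp add: romik_ext_measure_def)

lemma space_romik_ext_measure: "space romik_ext_measure = {0..1} \<times> {0..1}"
  by (simp add: romik_ext_measure_def)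

lemma measurable_romik_kernel [measurable]:
  assumes [measurable]: "f \<in> borel_measurable M" "g \<in> borel_measurable M"
  shows "(\<lambda>z. romik_kernel (f z) (g z)) \<in> borel_measurable M"
  unfolding romik_kernel_def by measurable

lemma romik_kernel_nonneg [simp]: "romik_kernel x y \<ge> 0"
  by (simp add: romik_kernel_def)

text \<open>The integral with respect to the invariant measure, written as an iterated Lebesgue integral over the
whole line; the form suited to substitution in one variable at a time.\<close>

definition romik_integral :: "(real \<times> real \<Rightarrow> ennreal) \<Rightarrow> ennreal" where
  "romik_integral F =
     (\<integral>\<^sup>+x. (\<integral>\<^sup>+y. F (x, y) * ennreal (romik_kernel x y) * indicator {0..1} y \<partial>lborel) *
        indicator {0..1} x \<partial>lborel)"

lemma nn_integral_romik_ext_measure: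
  assumes [measurable]: "F \<in> borel_measurable borel"
  shows "(\<integral>\<^sup>+z. F z \<partial>romik_ext_measure) = romik_integral F"
proof -
  have [measurable]: "F \<in> borel_measurable leb01_sq"
  proof -
    have "(\<lambda>z. (fst z, snd z)) \<in> measurable leb01_sq (borel \<Otimes>\<^sub>M borel)" by measurable
    hence "id \<in> measurable leb01_sq borel" by (simp add: borel_prod id_def)
    from measurable_compose[OF this assms] show ?thesis by simp
  qed
  have "(\<integral>\<^sup>+z. F z \<partial>romik_ext_measure) =
      (\<integral>\<^sup>+z. F z * ennreal (romik_kernel (fst z) (snd z)) \<partial>(leb01 \<Otimes>\<^sub>M leb01))"
    by (simp add: romik_ext_measure_altdef nn_integral_density mult.commute leb01_sq_def[symmetric])
  also have "\<dots> = (\<integral>\<^sup>+x. (\<integral>\<^sup>+y. F (x, y) * ennreal (romik_kernel x y) \<partial>leb01) \<partial>leb01)"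
    by (subst leb01.nn_integral_fst[symmetric]) (auto simp: leb01_sq_def[symmetric])
  also have "\<dots> = romik_integral F"
    unfolding romik_integral_def leb01_def by (simp add: nn_integral_restrict_space)
  finally show ?thesis .
qed

lemma nn_integral_substitution_antimono:
  fixes f :: "real \<Rightarrow> ennreal"
  assumes f[measurable]: "f \<in> borel_measurable borel"
    and deriv: "\<And>x. x \<in> {a..b} \<Longrightarrow> (g has_real_derivative - g' x) (at x)"
    and cont: "continuous_on {a..b} g'" and nonneg: "\<And>x. x \<in> {a..b} \<Longrightarrow> g' x \<ge> 0" and "a < b"
  shows "(\<integral>\<^sup>+x. f x * indicator {g b..g a} x \<partial>lborel) =
    (\<integral>\<^sup>+x. f (g x) * ennreal (g' x) * indicator {a..b} x \<partial>lborel)"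
proof -
  let ?h = "\<lambda>x. g (- x)"
  have "(\<integral>\<^sup>+x. f x * indicator {?h (-b)..?h (-a)} x \<partial>lborel) =
      (\<integral>\<^sup>+x. f (?h x) * ennreal (g' (-x)) * indicator {-b..-a} x \<partial>lborel)"
  proof (rule nn_integral_substitution_aux)
    fix x assume x: "x \<in> {-b..-a}"
    have "(g has_real_derivative - g' (-x)) (at (-x))" using x by (intro deriv) auto
    hence "(?h has_real_derivative (- g' (-x)) * (-1)) (at x)"
      by (intro DERIV_chain'[where f = "\<lambda>x. -x" and g = g]) (auto intro!: derivative_eq_intros)
    thus "(?h has_real_derivative g' (-x)) (at x)" by simp
  next
    show "continuous_on {-b..-a} (\<lambda>x. g' (-x))"
      by (intro continuous_on_compose2[OF cont]) (auto intro!: continuous_intros)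
  qed (use nonneg \<open>a < b\<close> in auto)
  also have "(\<integral>\<^sup>+x. f (?h x) * ennreal (g' (-x)) * indicator {-b..-a} x \<partial>lborel) =
      (\<integral>\<^sup>+x. f (g x) * ennreal (g' x) * indicator {a..b} x \<partial>lborel)"
  proof -
    have distr: "distr lborel borel (\<lambda>x. - x :: real) = lborel"
      using lborel_distr_uminus by (simp add: cong: distr_cong)
    have cg: "continuous_on {a..b} g"
      using deriv by (meson DERIV_continuous continuous_at_imp_continuous_on)
    have [measurable]: "(\<lambda>x. f (if x \<in> {a..b} then g x else 0)) \<in> borel_measurable borel"
      by (rule measurable_compose[OF _ f], rule borel_measurable_continuous_on_if) (use cg in auto)
    have [measurable]: "(\<lambda>x. if x \<in> {a..b} then g' x else 0) \<in> borel_measurable borel"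
      by (rule borel_measurable_continuous_on_if) (use cont in auto)
    let ?F = "\<lambda>x. f (if x \<in> {a..b} then g x else 0) * ennreal (if x \<in> {a..b} then g' x else 0) * indicator {a..b} x"
    have "(\<integral>\<^sup>+x. f (?h x) * ennreal (g' (-x)) * indicator {-b..-a} x \<partial>lborel) = (\<integral>\<^sup>+x. ?F (-x) \<partial>lborel)"
      by (intro nn_integral_cong) (auto split: split_indicator)
    also have "\<dots> = (\<integral>\<^sup>+x. ?F x \<partial>distr lborel borel (\<lambda>x. - x))"
      by (rule nn_integral_distr[symmetric]; measurable)
    also have "\<dots> = (\<integral>\<^sup>+x. f (g x) * ennreal (g' x) * indicator {a..b} x \<partial>lborel)"
      unfolding distr by (intro nn_integral_cong) (auto split: split_indicator)
    finally show ?thesis .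
  qed
  finally show ?thesis by simp
qed

text \<open>A branch \<open>(u, v)\<close> maps the strip \<open>[a, b] \<times> [0, 1]\<close> to \<open>[0, 1] \<times> [a, b]\<close>. In the
assumption \<open>k\<close>, \<open>u'\<close> and \<open>v'\<close> stand for the absolute values of the derivatives of \<open>u\<close> and \<open>v\<close>.\<close>

lemma romik_integral_branch:
  fixes F :: "real \<times> real \<Rightarrow> ennreal"
  assumes F: "F \<in> borel_measurable borel"
    and su: "\<And>f :: real \<Rightarrow> ennreal. f \<in> borel_measurable borel \<Longrightarrow>
      (\<integral>\<^sup>+x. f x * indicator {0..1} x \<partial>lborel) = (\<integral>\<^sup>+x. f (u x) * ennreal (u' x) * indicator {a..b} x \<partial>lborel)"
    and sv: "\<And>f :: real \<Rightarrow> ennreal. f \<in> borel_measurable borel \<Longrightarrow>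
      (\<integral>\<^sup>+y. f y * indicator {a..b} y \<partial>lborel) = (\<integral>\<^sup>+y. f (v y) * ennreal (v' y) * indicator {0..1} y \<partial>lborel)"
    and vm: "v \<in> borel_measurable borel" "v' \<in> borel_measurable borel"
    and k: "\<And>x y. x \<in> {a..b} \<Longrightarrow> y \<in> {0..1} \<Longrightarrow> 0 \<le> u' x \<and> 0 \<le> v' y \<and>
      romik_kernel x y = romik_kernel (u x) (v y) * v' y * u' x"
  shows "(\<integral>\<^sup>+x. (\<integral>\<^sup>+y. F (u x, v y) * ennreal (romik_kernel x y) * indicator {0..1} y \<partial>lborel) * indicator {a..b} x \<partial>lborel) =
    (\<integral>\<^sup>+x. (\<integral>\<^sup>+y. F (x, y) * ennreal (romik_kernel x y) * indicator {a..b} y \<partial>lborel) * indicator {0..1} x \<partial>lborel)"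
proof -
  note [measurable] = vm
  have [measurable]: "F \<in> borel_measurable (borel \<Otimes>\<^sub>M borel)" using F by (simp add: borel_prod)
  let ?f = "\<lambda>x. (\<integral>\<^sup>+y. F (x, y) * ennreal (romik_kernel x y) * indicator {a..b} y \<partial>lborel)"
  have fm: "?f \<in> borel_measurable borel" by measurable
  have "(\<integral>\<^sup>+y. F (u x, v y) * ennreal (romik_kernel x y) * indicator {0..1} y \<partial>lborel) = ?f (u x) * ennreal (u' x)"
    if x: "x \<in> {a..b}" for x
  proof -
    have "(\<integral>\<^sup>+y. F (u x, v y) * ennreal (romik_kernel x y) * indicator {0..1} y \<partial>lborel) =
        (\<integral>\<^sup>+y. (F (u x, v y) * ennreal (romik_kernel (u x) (v y))) * ennreal (v' y) * indicator {0..1} y * ennreal (u' x) \<partial>lborel)"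
      by (intro nn_integral_cong) (use k[OF x] in \<open>auto split: split_indicator simp: ennreal_mult mult_ac\<close>)
    also have "\<dots> = (\<integral>\<^sup>+y. (F (u x, v y) * ennreal (romik_kernel (u x) (v y))) * ennreal (v' y) * indicator {0..1} y \<partial>lborel) * ennreal (u' x)"
      by (rule nn_integral_multc) measurable
    also have "(\<integral>\<^sup>+y. (F (u x, v y) * ennreal (romik_kernel (u x) (v y))) * ennreal (v' y) * indicator {0..1} y \<partial>lborel) = ?f (u x)"
      by (rule sv[symmetric]) measurable
    finally show ?thesis .
  qed
  hence "(\<integral>\<^sup>+x. (\<integral>\<^sup>+y. F (u x, v y) * ennreal (romik_kernel x y) * indicator {0..1} y \<partial>lborel) * indicator {a..b} x \<partial>lborel) =
      (\<integral>\<^sup>+x. ?f (u x) * ennreal (u' x) * indicator {a..b} x \<partial>lborel)"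
    by (intro nn_integral_cong) (auto split: split_indicator)
  also have "\<dots> = (\<integral>\<^sup>+x. ?f x * indicator {0..1} x \<partial>lborel)"
    by (rule su[OF fm, symmetric])
  finally show ?thesis .
qed

lemma AE_indicator_branches:
  "AE x::real in lborel. indicator {0..1} x = (indicator {0..1/3} x + indicator {1/3..1/2} x + indicator {1/2..1} x :: ennreal)"
proof -
  have "AE x in lborel. x \<noteq> (1/3::real)" "AE x in lborel. x \<noteq> (1/2::real)"
    by (rule AE_lborel_singleton)+
  thus ?thesis by eventually_elim (auto simp: indicator_def)
qed

lemma romik_integral_invariant:
  assumes F: "F \<in> borel_measurable borel"
  shows "romik_integral (\<lambda>z. F (romik_ext z)) = romik_integral F"
proof -
  have [measurable]: "F \<in> borel_measurable (borel \<Otimes>\<^sub>M borel)" using F by (simp add: borel_prod)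
  \<comment> \<open>\<open>J\<close> is the contribution of one branch before the substitution, \<open>K\<close> that of its image strip.\<close>
  define J where "J u v I = (\<integral>\<^sup>+x. (\<integral>\<^sup>+y. F (u x, v y) * ennreal (romik_kernel x y) * indicator {0..1} y \<partial>lborel) * indicator I x \<partial>lborel)"
    for u v :: "real \<Rightarrow> real" and I
  define K where "K I = (\<integral>\<^sup>+x. (\<integral>\<^sup>+y. F (x, y) * ennreal (romik_kernel x y) * indicator I y \<partial>lborel) * indicator {0..1} x \<partial>lborel)"
    for I
  have b1: "J (\<lambda>x. x / (1 - 2 * x)) (\<lambda>y. y / (1 + 2 * y)) {0..1/3} = K {0..1/3}"
    unfolding J_def K_def
  proof (rule romik_integral_branch[where u' = "\<lambda>x. 1 / (1 - 2 * x)\<^sup>2" and v' = "\<lambda>y. 1 / (1 + 2 * y)\<^sup>2"])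
    fix f :: "real \<Rightarrow> ennreal" assume f: "f \<in> borel_measurable borel"
    have "(\<integral>\<^sup>+x. f x * indicator {0 / (1 - 2 * 0)..(1/3) / (1 - 2 * (1/3))} x \<partial>lborel) =
        (\<integral>\<^sup>+x. f (x / (1 - 2 * x)) * ennreal (1 / (1 - 2 * x)\<^sup>2) * indicator {0..1/3} x \<partial>lborel)"
    proof (rule nn_integral_substitution_aux)
      have nz: "1 - 2 * x \<noteq> 0" if "x \<in> {0..1/3}" for x :: real using that by auto
      fix x :: real assume x: "x \<in> {0..1/3}"
      show "((\<lambda>x. x / (1 - 2 * x)) has_real_derivative 1 / (1 - 2 * x)\<^sup>2) (at x)" using nz[OF x]
        by (auto intro!: derivative_eq_intros simp: power2_eq_square divide_simps)
    qed (auto intro!: continuous_intros f)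
    thus "(\<integral>\<^sup>+x. f x * indicator {0..1} x \<partial>lborel) =
        (\<integral>\<^sup>+x. f (x / (1 - 2 * x)) * ennreal (1 / (1 - 2 * x)\<^sup>2) * indicator {0..1/3} x \<partial>lborel)"
      by simp
    have "(\<integral>\<^sup>+x. f x * indicator {0 / (1 + 2 * 0)..1 / (1 + 2 * 1)} x \<partial>lborel) =
        (\<integral>\<^sup>+x. f (x / (1 + 2 * x)) * ennreal (1 / (1 + 2 * x)\<^sup>2) * indicator {0..1} x \<partial>lborel)"
    proof (rule nn_integral_substitution_aux)
      have nz: "1 + 2 * x \<noteq> 0" if "x \<in> {0..1}" for x :: real using that by auto
      fix x :: real assume x: "x \<in> {0..1}"
      show "((\<lambda>x. x / (1 + 2 * x)) has_real_derivative 1 / (1 + 2 * x)\<^sup>2) (at x)" using nz[OF x]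
        by (auto intro!: derivative_eq_intros simp: power2_eq_square divide_simps)
    qed (auto intro!: continuous_intros f)
    thus "(\<integral>\<^sup>+x. f x * indicator {0..1/3} x \<partial>lborel) =
        (\<integral>\<^sup>+x. f (x / (1 + 2 * x)) * ennreal (1 / (1 + 2 * x)\<^sup>2) * indicator {0..1} x \<partial>lborel)"
      by simp
  next
    fix x y :: real assume "x \<in> {0..1/3}" "y \<in> {0..1}"
    hence nz: "1 - 2 * x \<noteq> 0" "1 + 2 * y \<noteq> 0" by auto
    have "x / (1 - 2 * x) + y / (1 + 2 * y) - 2 * (x / (1 - 2 * x)) * (y / (1 + 2 * y)) =
        (x + y - 2 * x * y) / ((1 - 2 * x) * (1 + 2 * y))"
      using nz by (simp add: divide_simps) (simp add: algebra_simps)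
    thus "0 \<le> 1 / (1 - 2 * x)\<^sup>2 \<and> 0 \<le> 1 / (1 + 2 * y)\<^sup>2 \<and>
        romik_kernel x y = romik_kernel (x / (1 - 2 * x)) (y / (1 + 2 * y)) * (1 / (1 + 2 * y)\<^sup>2) * (1 / (1 - 2 * x)\<^sup>2)"
      using nz by (simp add: romik_kernel_def power_divide power_mult_distrib)
  qed (use F in measurable)
  have b2: "J (\<lambda>x. 1 / x - 2) (\<lambda>y. 1 / (y + 2)) {1/3..1/2} = K {1/3..1/2}"
    unfolding J_def K_def
  proof (rule romik_integral_branch[where u' = "\<lambda>x. 1 / x\<^sup>2" and v' = "\<lambda>y. 1 / (y + 2)\<^sup>2"])
    fix f :: "real \<Rightarrow> ennreal" assume f: "f \<in> borel_measurable borel"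
    have "(\<integral>\<^sup>+x. f x * indicator {1 / (1/2) - 2..1 / (1/3) - 2} x \<partial>lborel) =
        (\<integral>\<^sup>+x. f (1 / x - 2) * ennreal (1 / x\<^sup>2) * indicator {1/3..1/2} x \<partial>lborel)"
    proof (rule nn_integral_substitution_antimono)
      have nz: "x \<noteq> 0" if "x \<in> {1/3..1/2}" for x :: real using that by auto
      fix x :: real assume x: "x \<in> {1/3..1/2}"
      show "((\<lambda>x. 1 / x - 2) has_real_derivative - (1 / x\<^sup>2)) (at x)" using nz[OF x]
        by (auto intro!: derivative_eq_intros simp: power2_eq_square)
    qed (auto intro!: continuous_intros f)
    thus "(\<integral>\<^sup>+x. f x * indicator {0..1} x \<partial>lborel) =
        (\<integral>\<^sup>+x. f (1 / x - 2) * ennreal (1 / x\<^sup>2) * indicator {1/3..1/2} x \<partial>lborel)"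
      by simp
    have "(\<integral>\<^sup>+x. f x * indicator {1 / (1 + 2)..1 / (0 + 2)} x \<partial>lborel) =
        (\<integral>\<^sup>+x. f (1 / (x + 2)) * ennreal (1 / (x + 2)\<^sup>2) * indicator {0..1} x \<partial>lborel)"
    proof (rule nn_integral_substitution_antimono)
      have nz: "x + 2 \<noteq> 0" if "x \<in> {0..1}" for x :: real using that by auto
      fix x :: real assume x: "x \<in> {0..1}"
      show "((\<lambda>x. 1 / (x + 2)) has_real_derivative - (1 / (x + 2)\<^sup>2)) (at x)" using nz[OF x]
        by (auto intro!: derivative_eq_intros simp: power2_eq_square divide_simps)
    qed (auto intro!: continuous_intros f)
    thus "(\<integral>\<^sup>+x. f x * indicator {1/3..1/2} x \<partial>lborel) =
        (\<integral>\<^sup>+x. f (1 / (x + 2)) * ennreal (1 / (x + 2)\<^sup>2) * indicator {0..1} x \<partial>lborel)"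
      by simp
  next
    fix x y :: real assume "x \<in> {1/3..1/2}" "y \<in> {0..1}"
    hence nz: "x \<noteq> 0" "y + 2 \<noteq> 0" by auto
    have "(1 / x - 2) + 1 / (y + 2) - 2 * (1 / x - 2) * (1 / (y + 2)) =
        (x + y - 2 * x * y) / (x * (y + 2))"
      using nz by (simp add: divide_simps) (simp add: algebra_simps)
    thus "0 \<le> 1 / x\<^sup>2 \<and> 0 \<le> 1 / (y + 2)\<^sup>2 \<and>
        romik_kernel x y = romik_kernel (1 / x - 2) (1 / (y + 2)) * (1 / (y + 2)\<^sup>2) * (1 / x\<^sup>2)"
      using nz by (simp add: romik_kernel_def power_divide power_mult_distrib)
  qed (use F in measurable)
  have b3: "J (\<lambda>x. 2 - 1 / x) (\<lambda>y. 1 / (2 - y)) {1/2..1} = K {1/2..1}"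
    unfolding J_def K_def
  proof (rule romik_integral_branch[where u' = "\<lambda>x. 1 / x\<^sup>2" and v' = "\<lambda>y. 1 / (2 - y)\<^sup>2"])
    fix f :: "real \<Rightarrow> ennreal" assume f: "f \<in> borel_measurable borel"
    have "(\<integral>\<^sup>+x. f x * indicator {2 - 1 / (1/2)..2 - 1 / 1} x \<partial>lborel) =
        (\<integral>\<^sup>+x. f (2 - 1 / x) * ennreal (1 / x\<^sup>2) * indicator {1/2..1} x \<partial>lborel)"
    proof (rule nn_integral_substitution_aux)
      have nz: "x \<noteq> 0" if "x \<in> {1/2..1}" for x :: real using that by auto
      fix x :: real assume x: "x \<in> {1/2..1}"
      show "((\<lambda>x. 2 - 1 / x) has_real_derivative 1 / x\<^sup>2) (at x)" using nz[OF x]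
        by (auto intro!: derivative_eq_intros simp: power2_eq_square)
    qed (auto intro!: continuous_intros f)
    thus "(\<integral>\<^sup>+x. f x * indicator {0..1} x \<partial>lborel) =
        (\<integral>\<^sup>+x. f (2 - 1 / x) * ennreal (1 / x\<^sup>2) * indicator {1/2..1} x \<partial>lborel)"
      by simp
    have "(\<integral>\<^sup>+x. f x * indicator {1 / (2 - 0)..1 / (2 - 1)} x \<partial>lborel) =
        (\<integral>\<^sup>+x. f (1 / (2 - x)) * ennreal (1 / (2 - x)\<^sup>2) * indicator {0..1} x \<partial>lborel)"
    proof (rule nn_integral_substitution_aux)
      have nz: "2 - x \<noteq> 0" if "x \<in> {0..1}" for x :: real using that by auto
      fix x :: real assume x: "x \<in> {0..1}"
      show "((\<lambda>x. 1 / (2 - x)) has_real_derivative 1 / (2 - x)\<^sup>2) (at x)" using nz[OF x]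
        by (auto intro!: derivative_eq_intros simp: power2_eq_square divide_simps)
    qed (auto intro!: continuous_intros f)
    thus "(\<integral>\<^sup>+x. f x * indicator {1/2..1} x \<partial>lborel) =
        (\<integral>\<^sup>+x. f (1 / (2 - x)) * ennreal (1 / (2 - x)\<^sup>2) * indicator {0..1} x \<partial>lborel)"
      by simp
  next
    fix x y :: real assume "x \<in> {1/2..1}" "y \<in> {0..1}"
    hence nz: "x \<noteq> 0" "2 - y \<noteq> 0" by auto
    have "(2 - 1 / x) + 1 / (2 - y) - 2 * (2 - 1 / x) * (1 / (2 - y)) =
        (x + y - 2 * x * y) / (x * (2 - y))"
      using nz by (simp add: divide_simps) (simp add: algebra_simps)
    thus "0 \<le> 1 / x\<^sup>2 \<and> 0 \<le> 1 / (2 - y)\<^sup>2 \<and>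
        romik_kernel x y = romik_kernel (2 - 1 / x) (1 / (2 - y)) * (1 / (2 - y)\<^sup>2) * (1 / x\<^sup>2)"
      using nz by (simp add: romik_kernel_def power_divide power_mult_distrib)
  qed (use F in measurable)
  let ?I = "\<lambda>u v x. \<integral>\<^sup>+y. F (u x, v y) * ennreal (romik_kernel x y) * indicator {0..1} y \<partial>lborel"
  have "romik_integral (\<lambda>z. F (romik_ext z)) =
      (\<integral>\<^sup>+x. ?I (\<lambda>x. x / (1 - 2 * x)) (\<lambda>y. y / (1 + 2 * y)) x * indicator {0..1/3} x +
        ?I (\<lambda>x. 1 / x - 2) (\<lambda>y. 1 / (y + 2)) x * indicator {1/3..1/2} x +
        ?I (\<lambda>x. 2 - 1 / x) (\<lambda>y. 1 / (2 - y)) x * indicator {1/2..1} x \<partial>lborel)"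
    unfolding romik_integral_def
  proof (rule nn_integral_cong_AE)
    have "AE x in lborel. x \<noteq> (1/3::real)" "AE x in lborel. x \<noteq> (1/2::real)"
      by (rule AE_lborel_singleton)+
    thus "AE x in lborel.
      (\<integral>\<^sup>+y. F (romik_ext (x, y)) * ennreal (romik_kernel x y) * indicator {0..1} y \<partial>lborel) * indicator {0..1} x =
      ?I (\<lambda>x. x / (1 - 2 * x)) (\<lambda>y. y / (1 + 2 * y)) x * indicator {0..1/3} x +
        ?I (\<lambda>x. 1 / x - 2) (\<lambda>y. 1 / (y + 2)) x * indicator {1/3..1/2} x +
        ?I (\<lambda>x. 2 - 1 / x) (\<lambda>y. 1 / (2 - y)) x * indicator {1/2..1} x"
    proof eventually_elim
      case (elim x)
      then consider "x < 0" | "0 \<le> x" "x < 1/3" | "1/3 < x" "x < 1/2" | "1/2 < x" "x \<le> 1" | "x > 1"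
        by linarith
      thus ?case by cases auto
    qed
  qed
  also have "\<dots> = J (\<lambda>x. x / (1 - 2 * x)) (\<lambda>y. y / (1 + 2 * y)) {0..1/3} +
      J (\<lambda>x. 1 / x - 2) (\<lambda>y. 1 / (y + 2)) {1/3..1/2} + J (\<lambda>x. 2 - 1 / x) (\<lambda>y. 1 / (2 - y)) {1/2..1}"
    unfolding J_def by (simp add: nn_integral_add)
  also have "\<dots> = K {0..1/3} + K {1/3..1/2} + K {1/2..1}"
    by (simp only: b1 b2 b3)
  also have "\<dots> = romik_integral F"
  proof -
    have "(\<integral>\<^sup>+y. F (x, y) * ennreal (romik_kernel x y) * indicator {0..1} y \<partial>lborel) =
       (\<integral>\<^sup>+y. F (x, y) * ennreal (romik_kernel x y) * indicator {0..1/3} y \<partial>lborel) +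
       (\<integral>\<^sup>+y. F (x, y) * ennreal (romik_kernel x y) * indicator {1/3..1/2} y \<partial>lborel) +
       (\<integral>\<^sup>+y. F (x, y) * ennreal (romik_kernel x y) * indicator {1/2..1} y \<partial>lborel)" for x
    proof -
      have "(\<integral>\<^sup>+y. F (x, y) * ennreal (romik_kernel x y) * indicator {0..1} y \<partial>lborel) =
         (\<integral>\<^sup>+y. F (x, y) * ennreal (romik_kernel x y) * indicator {0..1/3} y +
          F (x, y) * ennreal (romik_kernel x y) * indicator {1/3..1/2} y +
          F (x, y) * ennreal (romik_kernel x y) * indicator {1/2..1} y \<partial>lborel)"
        using AE_indicator_branches
        by (intro nn_integral_cong_AE) (auto elim!: eventually_mono simp: distrib_left)
      thus ?thesis by (simp add: nn_integral_add)
    qed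
    thus ?thesis
      unfolding romik_integral_def K_def by (simp add: distrib_right nn_integral_add)
  qed
  finally show ?thesis .
qed

lemma measure_preserving_romik_ext: "measure_preserving romik_ext_measure romik_ext_measure romik_ext"
  unfolding measure_preserving_def
proof (intro conjI ballI)
  show T: "romik_ext \<in> measurable romik_ext_measure romik_ext_measure"
    by measurable
  fix B assume B: "B \<in> sets romik_ext_measure"
  hence B'[measurable]: "B \<in> sets borel"
    by (simp add: sets_romik_ext_measure sets_leb01_sq_iff)
  have "emeasure romik_ext_measure (romik_ext -` B \<inter> space romik_ext_measure) =
      (\<integral>\<^sup>+z. indicator (romik_ext -` B \<inter> space romik_ext_measure) z \<partial>romik_ext_measure)"
    using measurable_sets[OF T B] by (intro nn_integral_indicator[symmetric])
  also have "\<dots> = (\<integral>\<^sup>+z. indicator B (romik_ext z) \<partial>romik_ext_measure)"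
    by (intro nn_integral_cong) (auto split: split_indicator)
  also have "\<dots> = romik_integral (\<lambda>z. indicator B (romik_ext z))"
    by (intro nn_integral_romik_ext_measure) measurable
  also have "\<dots> = romik_integral (indicator B)"
    by (rule romik_integral_invariant) measurable
  also have "\<dots> = emeasure romik_ext_measure B"
    using nn_integral_romik_ext_measure[OF borel_measurable_indicator[OF B']] B by simp
  finally show "emeasure romik_ext_measure (romik_ext -` B \<inter> space romik_ext_measure) = emeasure romik_ext_measure B" .
qed

lemma sigma_finite_romik_ext_measure: "sigma_finite_measure romik_ext_measure"
proof -
  interpret leb01_sq: sigma_finite_measure leb01_sq
    unfolding leb01_sq_def by (rule leb01_pair.sigma_finite_measure_axioms)
  show ?thesis
    unfolding romik_ext_measure_altdef by (subst leb01_sq.sigma_finite_iff_density_finite) auto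
qed

lemma absolutely_continuous_romik_ext_measure: "absolutely_continuous leb01_sq romik_ext_measure"
  unfolding romik_ext_measure_altdef by (intro absolutely_continuousI_density) measurable

lemma AE_romik_ext_measure_irrational_square: "AE z in romik_ext_measure. z \<in> irrational_square"
  using absolutely_continuous_AE[OF _ absolutely_continuous_romik_ext_measure AE_irrational_square]
  by (simp add: sets_romik_ext_measure)

lemma nn_integral_romik_kernel:
  assumes x: "0 < x" "x < 1"
  shows "(\<integral>\<^sup>+y. ennreal (romik_kernel x y) * indicator {0..1} y \<partial>lborel) = ennreal (1 / (x * (1 - x)))"
proof -
  have pos: "x + y - 2 * x * y > 0" if "y \<in> {0..1}" for y
  proof -
    have "x * (1 - y) + y * (1 - x) > 0"
      using x that by (cases "y = 0") (auto intro!: add_nonneg_pos)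
    thus ?thesis by (simp add: algebra_simps)
  qed
  have "(\<integral>\<^sup>+y. ennreal (romik_kernel x y) * indicator {0..1} y \<partial>lborel) =
      ennreal (1 / (x * (x + 1 - 2 * x * 1)) - 0 / (x * (x + 0 - 2 * x * 0)))"
  \<comment> \<open>The antiderivative \<open>y / (x (x + y - 2xy))\<close> in \<open>y\<close> has no singularity at \<open>x = 1/2\<close>.\<close>
  proof (rule nn_integral_FTC_Icc)
    fix y :: real assume y: "y \<in> {0..1}"
    have "((\<lambda>y. y / (x * (x + y - 2 * x * y))) has_real_derivative
        (1 * (x * (x + y - 2 * x * y)) - y * (x * (1 - 2 * x))) / (x * (x + y - 2 * x * y))\<^sup>2) (at y)"
      using pos[OF y] x
      by (auto intro!: derivative_eq_intros simp: power2_eq_square)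
    also have "(1 * (x * (x + y - 2 * x * y)) - y * (x * (1 - 2 * x))) / (x * (x + y - 2 * x * y))\<^sup>2 = romik_kernel x y"
      using pos[OF y] x by (simp add: romik_kernel_def divide_simps power_mult_distrib) (simp add: algebra_simps power2_eq_square)
    finally show "((\<lambda>y. y / (x * (x + y - 2 * x * y))) has_real_derivative romik_kernel x y) (at y)" .
  qed auto
  also have "1 / (x * (x + 1 - 2 * x * 1)) - 0 / (x * (x + 0 - 2 * x * 0)) = 1 / (x * (1 - x))"
    by (simp add: algebra_simps)
  finally show ?thesis .
qed

lemma measure_preserving_fst: "measure_preserving romik_ext_measure romik_measure fst"
  unfolding measure_preserving_def
proof (intro conjI ballI)
  have fst': "fst \<in> measurable leb01_sq leb01"
    unfolding leb01_sq_def by measurable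
  thus fst: "fst \<in> measurable romik_ext_measure romik_measure"
    by (simp add: romik_measure_def sets_romik_ext_measure cong: measurable_cong_sets)
  fix A assume A: "A \<in> sets romik_measure"
  hence A': "A \<in> sets leb01" by (simp add: romik_measure_def)
  hence [measurable]: "A \<in> sets borel" by (simp add: sets_leb01_iff)
  have dens: "(\<lambda>x. ennreal (1 / (x * (1 - x)))) \<in> borel_measurable leb01"
    unfolding leb01_def by (intro measurable_restrict_space1) measurable
  have [measurable]: "(\<lambda>z :: real \<times> real. indicator A (fst z) :: ennreal) \<in> borel_measurable borel"
  proof -
    have "(\<lambda>z :: real \<times> real. indicator A (fst z) :: ennreal) \<in> borel_measurable (borel \<Otimes>\<^sub>M (borel :: real measure))"
      by measurable
    thus ?thesis by (simp add: borel_prod)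
  qed
  have "emeasure romik_ext_measure (fst -` A \<inter> space romik_ext_measure) =
      (\<integral>\<^sup>+z. indicator (fst -` A \<inter> space romik_ext_measure) z \<partial>romik_ext_measure)"
    using measurable_sets[OF fst A] by (intro nn_integral_indicator[symmetric])
  also have "\<dots> = (\<integral>\<^sup>+z. indicator A (fst z) \<partial>romik_ext_measure)"
    by (intro nn_integral_cong) (auto split: split_indicator)
  also have "\<dots> = romik_integral (\<lambda>z. indicator A (fst z))"
    by (intro nn_integral_romik_ext_measure) measurable
  also have "\<dots> = (\<integral>\<^sup>+x. ennreal (1 / (x * (1 - x))) * indicator A x * indicator {0..1} x \<partial>lborel)"
    unfolding romik_integral_def
  proof (rule nn_integral_cong_AE)
    have "AE x in lborel. x \<noteq> (0::real)" "AE x in lborel. x \<noteq> (1::real)"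
      by (rule AE_lborel_singleton)+
    thus "AE x in lborel. (\<integral>\<^sup>+y. indicator A (fst (x, y)) * ennreal (romik_kernel x y) * indicator {0..1} y \<partial>lborel) * indicator {0..1} x =
      ennreal (1 / (x * (1 - x))) * indicator A x * indicator {0..1} x"
    proof eventually_elim
      case (elim x)
      show ?case
        using elim nn_integral_romik_kernel[of x] by (auto split: split_indicator)
    qed
  qed
  also have "\<dots> = emeasure romik_measure A"
    unfolding romik_measure_def using A'
    by (subst emeasure_density[OF dens]) (auto simp: leb01_def nn_integral_restrict_space)
  finally show "emeasure romik_ext_measure (fst -` A \<inter> space romik_ext_measure) = emeasure romik_measure A" .
qed

lemma measure_preserving_system_romik_ext: "measure_preserving_system romik_ext_measure romik_ext"
  using sigma_finite_romik_ext_measure measure_preserving_romik_ext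
  by (simp add: measure_preserving_system_def)

lemma measure_preserving_system_romik: "measure_preserving_system romik_measure romik"
  unfolding measure_preserving_system_def
proof
  show "sigma_finite_measure romik_measure"
    unfolding romik_measure_def by (subst leb01.sigma_finite_iff_density_finite)
      (auto simp: sets_leb01 cong: measurable_cong_sets intro!: measurable_restrict_space1)
  have "romik \<in> measurable romik_measure romik_measure"
    using measurable_romik by (simp add: romik_measure_def)
  thus "measure_preserving romik_measure romik_measure romik"
    using factor_measure_preserving[OF measure_preserving_romik_ext measure_preserving_fst] fst_romik_ext
    by blast
qed

lemma natural_extension_romik:
  "natural_extension_via romik_ext_measure romik_ext romik_measure romik fst"
proof -
  have "ae_bijective romik_ext_measure romik_ext"
    using ae_bijective_romik_ext absolutely_continuous_romik_ext_measure
    by (auto simp: ae_bijective_def absolutely_continuous_def space_romik_ext_measure)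
  thus ?thesis
    using measure_preserving_system_romik_ext measure_preserving_system_romik measure_preserving_fst fst_romik_ext
    by (simp add: natural_extension_via_def factor_map_def)
qed


section \<open>Ergodicity\<close>

text \<open>The region in which the returns are studied: the corner squares removed contain the singularities
\<open>(0, 0)\<close> and \<open>(1, 1)\<close> of the density. A point lies in one of them if the step into it and the step out
of it both use the first branch, or both use the third.\<close>

definition romik_core :: "(real \<times> real) set" where
  "romik_core = {z \<in> irrational_square.
     \<not> (fst z < 1/3 \<and> snd z < 1/3) \<and> \<not> (fst z > 1/2 \<and> snd z > 1/2)}"

lemma romik_core_subset: "romik_core \<subseteq> irrational_square"
  by (auto simp: romik_core_def)

lemma snd_romik_ext:
  assumes "z \<in> irrational_square"
  shows "snd (romik_ext z) < 1/3 \<longleftrightarrow> fst z < 1/3" "snd (romik_ext z) > 1/2 \<longleftrightarrow> fst z > 1/2"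
proof -
  obtain x y where z: "z = (x, y)" by (cases z)
  have *: "0 < x" "x < 1" "0 < y" "y < 1" "x \<noteq> 1/3" "x \<noteq> 1/2"
    using assms irrational_ne[of x] by (auto simp: z)
  have b: "y / (1 + 2 * y) < 1/3" "1/3 < 1 / (y + 2)" "1 / (y + 2) < 1/2" "1/2 < 1 / (2 - y)"
    using * by (simp_all add: field_simps)
  consider "x < 1/3" | "1/3 < x" "x < 1/2" | "1/2 < x" using * by linarith
  hence "(snd (romik_ext z) < 1/3 \<longleftrightarrow> fst z < 1/3) \<and> (snd (romik_ext z) > 1/2 \<longleftrightarrow> fst z > 1/2)"
    by cases (use b in \<open>auto simp: z\<close>)
  thus "snd (romik_ext z) < 1/3 \<longleftrightarrow> fst z < 1/3" "snd (romik_ext z) > 1/2 \<longleftrightarrow> fst z > 1/2"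
    by auto
qed

text \<open>The image of a point lies in the core or not according to its first coordinate alone, because the
second coordinate of the image records which branch was used.\<close>

lemma romik_ext_mem_core_iff:
  assumes "z \<in> irrational_square"
  shows "romik_ext z \<in> romik_core \<longleftrightarrow>
    \<not> (romik (fst z) < 1/3 \<and> fst z < 1/3) \<and> \<not> (romik (fst z) > 1/2 \<and> fst z > 1/2)"
  using snd_romik_ext[OF assms] romik_ext_irrational_square[OF assms]
  by (simp add: romik_core_def fst_romik_ext)

lemma funpow_irrational_square:
  "z \<in> irrational_square \<Longrightarrow> (romik_ext ^^ k) z \<in> irrational_square"
  by (induction k) (simp_all add: romik_ext_irrational_square del: romik_ext.simps)

text \<open>An orbit that avoids the core uses the first branch forever or the third branch forever. This is
impossible, as these branches decrease \<open>1 / x\<close> by \<open>2\<close> and \<open>1 / (1 - x)\<close> by \<open>1\<close>, respectively.\<close>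

lemma enters_romik_core:
  assumes z: "z \<in> irrational_square"
  shows "\<exists>k. (romik_ext ^^ k) z \<in> romik_core"
proof (rule ccontr)
  assume "\<not> ?thesis"
  hence out: "(romik_ext ^^ k) z \<notin> romik_core" for k by blast
  define x where "x k = fst ((romik_ext ^^ k) z)" for k
  have irr: "(romik_ext ^^ k) z \<in> irrational_square" for k
    using z by (rule funpow_irrational_square)
  have x01: "0 < x k \<and> x k < 1" for k
    using irr[of k] by (auto simp: x_def irrational_square_def)
  have xS: "x (Suc k) = romik (x k)" for k
    by (simp add: x_def fst_romik_ext)
  have out': "x (Suc k) < 1/3 \<and> x k < 1/3 \<or> x (Suc k) > 1/2 \<and> x k > 1/2" for k
    using romik_ext_mem_core_iff[OF irr[of k]] out[of "Suc k"] xS[of k] by (auto simp: x_def)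
  consider "x 0 < 1/3" | "x 0 > 1/2" using out'[of 0] by auto
  thus False
  proof cases
    case 1
    have "x k < 1/3 \<and> 1 / x k = 1 / x 0 - 2 * real k" for k
    proof (induction k)
      case (Suc k)
      have "x (Suc k) < 1/3" using Suc out'[of k] by auto
      moreover have "1 / x (Suc k) = 1 / x k - 2"
        using Suc x01[of k] by (simp add: xS romik_def field_simps)
      ultimately show ?case using Suc by simp
    qed (use 1 in simp)
    moreover obtain k where "1 / x 0 < real k" using reals_Archimedean2 by blast
    ultimately have "1 / x k < 0" by (smt (verit) of_nat_0_le_iff)
    thus False using x01[of k] by (simp add: field_simps)
  next
    case 2
    have "x k > 1/2 \<and> 1 / (1 - x k) = 1 / (1 - x 0) - real k" for k
    proof (induction k)
      case (Suc k)
      have "x (Suc k) > 1/2" using Suc out'[of k] by auto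
      moreover have "1 / (1 - x (Suc k)) = 1 / (1 - x k) - 1"
        using Suc x01[of k] by (simp add: xS romik_def field_simps)
      ultimately show ?case using Suc by simp
    qed (use 2 in simp)
    moreover obtain k where "1 / (1 - x 0) < real k" using reals_Archimedean2 by blast
    ultimately have "1 / (1 - x k) < 0" by (smt (verit))
    thus False using x01[of k] by (simp add: field_simps)
  qed
qed

text \<open>On vertical fibres the map does not expand, and it contracts if both points are in the core: there
\<open>y \<ge> 1/3\<close> on the first strip and \<open>y \<le> 1/2\<close> on the third one, so the products of the denominators
are at least \<open>25/9\<close> and \<open>9/4\<close>; on the middle strip the product is at least \<open>4\<close> everywhere.\<close>

lemma romik_ext_contraction:
  assumes z: "z \<in> irrational_square" "z' \<in> irrational_square" and eq: "fst z = fst z'"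
  shows "\<bar>snd (romik_ext z) - snd (romik_ext z')\<bar> \<le> \<bar>snd z - snd z'\<bar>"
    and "z \<in> romik_core \<Longrightarrow> z' \<in> romik_core \<Longrightarrow>
      \<bar>snd (romik_ext z) - snd (romik_ext z')\<bar> \<le> 4/9 * \<bar>snd z - snd z'\<bar>"
proof -
  obtain x y y' where zz: "z = (x, y)" "z' = (x, y')"
    using eq by (cases z; cases z') auto
  have *: "0 < x" "x < 1" "0 < y" "y < 1" "0 < y'" "y' < 1" "x \<noteq> 1/3" "x \<noteq> 1/2"
    using z irrational_ne[of x] by (auto simp: zz)
  have div: "\<bar>a / q\<bar> \<le> \<bar>a\<bar> / c" if "q \<ge> c" "c > 0" for a q c :: real
  proof -
    have "\<bar>a / q\<bar> = \<bar>a\<bar> / q" using that by (simp add: abs_divide)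
    also have "\<dots> \<le> \<bar>a\<bar> / c" by (rule divide_left_mono) (use that in auto)
    finally show ?thesis .
  qed
  have "\<exists>q. q \<ge> 1 \<and> (z \<in> romik_core \<and> z' \<in> romik_core \<longrightarrow> q \<ge> 9/4) \<and>
      \<bar>snd (romik_ext z) - snd (romik_ext z')\<bar> = \<bar>(y - y') / q\<bar>"
  proof -
    consider "x < 1/3" | "1/3 < x" "x < 1/2" | "1/2 < x" using * by linarith
    thus ?thesis
    proof cases
      case 1
      have "1 * 1 \<le> (1 + 2 * y) * (1 + 2 * y')"
        using * by (intro mult_mono) auto
      moreover have "9/4 \<le> (1 + 2 * y) * (1 + 2 * y')" if "z \<in> romik_core" "z' \<in> romik_core"
      proof -
        have "(5/3) * (5/3) \<le> (1 + 2 * y) * (1 + 2 * y')"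
          using that 1 * by (intro mult_mono) (auto simp: romik_core_def zz)
        thus ?thesis by simp
      qed
      moreover have "y / (1 + 2 * y) - y' / (1 + 2 * y') = (y - y') / ((1 + 2 * y) * (1 + 2 * y'))"
        using * by (simp add: field_simps)
      ultimately show ?thesis using 1
        by (intro exI[of _ "(1 + 2 * y) * (1 + 2 * y')"]) (auto simp: zz)
    next
      case 2
      have "2 * 2 \<le> (y + 2) * (y' + 2)"
        using * by (intro mult_mono) auto
      moreover have "1 / (y + 2) - 1 / (y' + 2) = - ((y - y') / ((y + 2) * (y' + 2)))"
        using * by (simp add: divide_simps)
      ultimately show ?thesis using 2
        by (intro exI[of _ "(y + 2) * (y' + 2)"]) (auto simp: zz)
    next
      case 3
      have "1 * 1 \<le> (2 - y) * (2 - y')"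
        using * by (intro mult_mono) auto
      moreover have "9/4 \<le> (2 - y) * (2 - y')" if "z \<in> romik_core" "z' \<in> romik_core"
      proof -
        have "(3/2) * (3/2) \<le> (2 - y) * (2 - y')"
          using that 3 * by (intro mult_mono) (auto simp: romik_core_def zz)
        thus ?thesis by simp
      qed
      moreover have "1 / (2 - y) - 1 / (2 - y') = (y - y') / ((2 - y) * (2 - y'))"
        using * by (simp add: field_simps)
      ultimately show ?thesis using 3
        by (intro exI[of _ "(2 - y) * (2 - y')"]) (auto simp: zz)
    qed
  qed
  then obtain q where q: "q \<ge> 1" "z \<in> romik_core \<and> z' \<in> romik_core \<longrightarrow> q \<ge> 9/4"
    "\<bar>snd (romik_ext z) - snd (romik_ext z')\<bar> = \<bar>(y - y') / q\<bar>" by blast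
  show "\<bar>snd (romik_ext z) - snd (romik_ext z')\<bar> \<le> \<bar>snd z - snd z'\<bar>"
    using q(1,3) div[of 1 q "y - y'"] by (simp add: zz)
  show "\<bar>snd (romik_ext z) - snd (romik_ext z')\<bar> \<le> 4/9 * \<bar>snd z - snd z'\<bar>"
    if "z \<in> romik_core" "z' \<in> romik_core"
    using q(2,3) that div[of "9/4" q "y - y'"] by (simp add: zz)
qed

lemma funpow_romik_ext_nonexpanding:
  assumes z: "z \<in> irrational_square" "z' \<in> irrational_square" and eq: "fst z = fst z'"
  shows "fst ((romik_ext ^^ k) z) = fst ((romik_ext ^^ k) z') \<and>
    \<bar>snd ((romik_ext ^^ k) z) - snd ((romik_ext ^^ k) z')\<bar> \<le> \<bar>snd z - snd z'\<bar>"
proof (induction k)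
  case (Suc k)
  have "\<bar>snd (romik_ext ((romik_ext ^^ k) z)) - snd (romik_ext ((romik_ext ^^ k) z'))\<bar>
      \<le> \<bar>snd ((romik_ext ^^ k) z) - snd ((romik_ext ^^ k) z')\<bar>"
    using Suc z by (intro romik_ext_contraction funpow_irrational_square) auto
  thus ?case using Suc by (auto simp: fst_romik_ext)
qed (use eq in simp)

abbreviation core_return :: "real \<times> real \<Rightarrow> real \<times> real" where
  "core_return \<equiv> first_return_map romik_ext romik_core"

lemma core_return_ex:
  "z \<in> romik_core \<Longrightarrow> \<exists>k. (romik_ext ^^ k) (romik_ext z) \<in> romik_core"
  using enters_romik_core romik_ext_irrational_square romik_core_subset by blast

lemma core_return_mem: "z \<in> romik_core \<Longrightarrow> core_return z \<in> romik_core"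
  by (rule first_return_map_in) (rule core_return_ex)

text \<open>Points of the core on the same vertical fibre return at the same time. The first step contracts, and
the remaining ones until the return do not expand.\<close>

lemma core_return_contraction:
  assumes z: "z \<in> romik_core" "z' \<in> romik_core" and eq: "fst z = fst z'"
  shows "fst (core_return z) = fst (core_return z')"
    and "\<bar>snd (core_return z) - snd (core_return z')\<bar> \<le> 4/9 * \<bar>snd z - snd z'\<bar>"
proof -
  have irr: "z \<in> irrational_square" "z' \<in> irrational_square"
    using z romik_core_subset by auto
  have swap: "(romik_ext ^^ k) (romik_ext w) = romik_ext ((romik_ext ^^ k) w)" for k w
    by (simp add: funpow_swap1)
  have "(romik_ext ^^ k) (romik_ext z) \<in> romik_core \<longleftrightarrow> (romik_ext ^^ k) (romik_ext z') \<in> romik_core" for k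
    using funpow_romik_ext_nonexpanding[OF irr eq, of k]
    by (simp add: swap romik_ext_mem_core_iff funpow_irrational_square irr del: romik_ext.simps)
  then obtain k where k: "core_return z = (romik_ext ^^ k) (romik_ext z)"
      "core_return z' = (romik_ext ^^ k) (romik_ext z')"
    by (simp add: first_return_map_def)
  have irr': "romik_ext z \<in> irrational_square" "romik_ext z' \<in> irrational_square"
    using irr by (auto intro: romik_ext_irrational_square simp del: romik_ext.simps)
  have eq': "fst (romik_ext z) = fst (romik_ext z')" using eq by (simp add: fst_romik_ext)
  show "fst (core_return z) = fst (core_return z')"
    using funpow_romik_ext_nonexpanding[OF irr' eq'] by (simp add: k)
  have "\<bar>snd (core_return z) - snd (core_return z')\<bar> \<le> \<bar>snd (romik_ext z) - snd (romik_ext z')\<bar>"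
    using funpow_romik_ext_nonexpanding[OF irr' eq'] by (simp add: k)
  also have "\<dots> \<le> 4/9 * \<bar>snd z - snd z'\<bar>"
    by (rule romik_ext_contraction(2)[OF irr eq z])
  finally show "\<bar>snd (core_return z) - snd (core_return z')\<bar> \<le> 4/9 * \<bar>snd z - snd z'\<bar>" .
qed

lemma funpow_core_return_mem: "z \<in> romik_core \<Longrightarrow> (core_return ^^ n) z \<in> romik_core"
  by (induction n) (simp_all add: core_return_mem)

lemma dist_funpow_core_return:
  assumes z: "z \<in> romik_core" "z' \<in> romik_core" and eq: "fst z = fst z'"
  shows "dist ((core_return ^^ n) z) ((core_return ^^ n) z') \<le> (4/9) ^ n"
proof -
  have "fst ((core_return ^^ n) z) = fst ((core_return ^^ n) z') \<and>
    \<bar>snd ((core_return ^^ n) z) - snd ((core_return ^^ n) z')\<bar> \<le> (4/9) ^ n"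
  proof (induction n)
    case 0
    have "\<bar>snd z - snd z'\<bar> \<le> 1"
      using z by (cases z; cases z') (auto simp: romik_core_def)
    thus ?case using eq by simp
  next
    case (Suc n)
    let ?w = "(core_return ^^ n) z" and ?w' = "(core_return ^^ n) z'"
    have w: "?w \<in> romik_core" "?w' \<in> romik_core" "fst ?w = fst ?w'"
      using Suc z by (auto intro: funpow_core_return_mem)
    from core_return_contraction[OF this] Suc show ?case by auto
  qed
  thus ?thesis
    by (simp add: dist_prod_def dist_real_def)
qed


text \<open>Invariance of a set under the planar map, tested only on the irrational square.\<close>

definition romik_invariant :: "(real \<times> real) set \<Rightarrow> bool" where
  "romik_invariant D \<longleftrightarrow> (\<forall>z\<in>irrational_square. romik_ext z \<in> D \<longleftrightarrow> z \<in> D)"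

lemma romik_invariant_funpow:
  assumes "romik_invariant D" "z \<in> irrational_square"
  shows "(romik_ext ^^ k) z \<in> D \<longleftrightarrow> z \<in> D"
  using assms funpow_irrational_square[OF assms(2)]
  by (induction k) (auto simp: romik_invariant_def simp del: romik_ext.simps)

lemma romik_invariant_core_return:
  assumes "romik_invariant D" "z \<in> romik_core"
  shows "(core_return ^^ n) z \<in> D \<longleftrightarrow> z \<in> D"
proof (induction n)
  case (Suc n)
  let ?w = "(core_return ^^ n) z"
  have w: "?w \<in> irrational_square"
    using funpow_core_return_mem[OF assms(2)] romik_core_subset by blast
  have "core_return ?w \<in> D \<longleftrightarrow> romik_ext ?w \<in> D"
    by (subst first_return_map_def) (rule romik_invariant_funpow[OF assms(1) romik_ext_irrational_square[OF w]])
  also have "\<dots> \<longleftrightarrow> ?w \<in> D"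
    using assms(1) w by (simp add: romik_invariant_def)
  finally show ?case using Suc by simp
qed simp

lemma romik_invariant_swap:
  assumes "romik_invariant D"
  shows "romik_invariant (prod.swap -` D)"
  unfolding romik_invariant_def
proof
  fix z assume z: "z \<in> irrational_square"
  let ?w = "prod.swap (romik_ext z)"
  have "?w \<in> irrational_square" using z by (simp add: romik_ext_irrational_square del: romik_ext.simps)
  moreover have "romik_ext ?w = prod.swap z"
    using romik_ext_swap[of "prod.swap z"] z by simp
  ultimately have "prod.swap z \<in> D \<longleftrightarrow> ?w \<in> D"
    using assms unfolding romik_invariant_def by metis
  thus "romik_ext z \<in> prod.swap -` D \<longleftrightarrow> z \<in> prod.swap -` D" by simp
qed

lemma romik_invariant_Int_space:
  "romik_invariant D \<Longrightarrow> romik_invariant (D \<inter> {0..1} \<times> {0..1})"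
  using irrational_square_subset romik_ext_irrational_square by (auto simp: romik_invariant_def simp del: romik_ext.simps)

lemma romik_invariant_Diff_space:
  "romik_invariant D \<Longrightarrow> romik_invariant ({0..1} \<times> {0..1} - D)"
  using irrational_square_subset romik_ext_irrational_square by (auto simp: romik_invariant_def simp del: romik_ext.simps)

lemma romik_core_sets [measurable]: "romik_core \<in> sets leb01_sq"
proof -
  have "romik_core = {z \<in> space leb01_sq. z \<in> irrational_square \<and>
      \<not> (fst z < 1/3 \<and> snd z < 1/3) \<and> \<not> (fst z > 1/2 \<and> snd z > 1/2)}"
    using irrational_square_subset by (auto simp: romik_core_def)
  also have "\<dots> \<in> sets leb01_sq" by measurable
  finally show ?thesis .
qed

lemma romik_kernel_ge_1:
  assumes "z \<in> irrational_square"
  shows "romik_kernel (fst z) (snd z) \<ge> 1"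
proof -
  obtain x y where z: "z = (x, y)" by (cases z)
  have *: "0 < x" "x < 1" "0 < y" "y < 1" using assms by (auto simp: z)
  have "0 < x * (1 - y) + y * (1 - x)" using * by (intro add_pos_pos) auto
  moreover have "0 \<le> x * y + (1 - x) * (1 - y)" using * by (intro add_nonneg_nonneg) auto
  ultimately have "0 < x + y - 2 * x * y" "x + y - 2 * x * y \<le> 1" by (auto simp: algebra_simps)
  hence "(x + y - 2 * x * y)\<^sup>2 \<le> 1" "(x + y - 2 * x * y)\<^sup>2 > 0" by (auto intro: power_le_one)
  thus ?thesis by (simp add: z romik_kernel_def)
qed

lemma romik_kernel_le_36:
  assumes "z \<in> romik_core"
  shows "romik_kernel (fst z) (snd z) \<le> 36"
proof -
  obtain x y where z: "z = (x, y)" by (cases z)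
  have *: "0 < x" "x < 1" "0 < y" "y < 1" "\<not> (x < 1/3 \<and> y < 1/3)" "\<not> (x > 1/2 \<and> y > 1/2)"
    using assms by (auto simp: z romik_core_def)
  have pos: "0 \<le> x * (1 - y)" "0 \<le> y * (1 - x)" using * by auto
  consider "x \<ge> 1/3" "y \<le> 1/2" | "y \<ge> 1/3" "x \<le> 1/2" using * by linarith
  hence "1/6 \<le> x * (1 - y) + y * (1 - x)"
  proof cases
    case 1
    hence "1/3 * (1/2) \<le> x * (1 - y)" by (intro mult_mono) auto
    thus ?thesis using pos by linarith
  next
    case 2
    hence "1/3 * (1/2) \<le> y * (1 - x)" by (intro mult_mono) auto
    thus ?thesis using pos by linarith
  qed
  hence "1/6 \<le> x + y - 2 * x * y" by (simp add: algebra_simps)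
  hence "(1/6)\<^sup>2 \<le> (x + y - 2 * x * y)\<^sup>2" by (intro power_mono) auto
  hence "1 / (x + y - 2 * x * y)\<^sup>2 \<le> 1 / (1/6)\<^sup>2" by (intro divide_left_mono) (auto intro!: mult_pos_pos)
  thus ?thesis by (simp add: z romik_kernel_def power2_eq_square)
qed

lemma emeasure_leb01_sq_space: "emeasure leb01_sq ({0..1} \<times> {0..1}) = 1"
proof -
  have "emeasure leb01_sq ({0..1} \<times> {0..1}) = emeasure leb01 {0..1} * emeasure leb01 {0..1}"
    unfolding leb01_sq_def by (intro leb01.emeasure_pair_measure_Times) (auto simp: sets_leb01_iff)
  thus ?thesis by (simp add: emeasure_leb01)
qed

lemma emeasure_romik_ext_measure:
  "A \<in> sets leb01_sq \<Longrightarrow> emeasure romik_ext_measure A =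
     (\<integral>\<^sup>+z. ennreal (romik_kernel (fst z) (snd z)) * indicator A z \<partial>leb01_sq)"
  unfolding romik_ext_measure_altdef by (rule emeasure_density) auto

lemma emeasure_romik_core_finite: "emeasure romik_ext_measure romik_core < \<infinity>"
proof -
  have "emeasure romik_ext_measure romik_core \<le> (\<integral>\<^sup>+z. 36 * indicator romik_core z \<partial>leb01_sq)"
    unfolding emeasure_romik_ext_measure[OF romik_core_sets]
  proof (intro nn_integral_mono)
    fix z
    show "ennreal (romik_kernel (fst z) (snd z)) * indicator romik_core z \<le> 36 * indicator romik_core z"
      using romik_kernel_le_36[of z] ennreal_leI[of "romik_kernel (fst z) (snd z)" 36]
      by (auto split: split_indicator)
  qed
  also have "\<dots> = 36 * emeasure leb01_sq romik_core"
    by (rule nn_integral_cmult_indicator) measurable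
  also have "\<dots> \<le> 36 * emeasure leb01_sq ({0..1} \<times> {0..1})"
    by (intro mult_left_mono emeasure_mono)
      (use sets.top[of leb01_sq] romik_core_subset irrational_square_subset in auto)
  also have "\<dots> < \<infinity>" by (simp add: emeasure_leb01_sq_space)
  finally show ?thesis .
qed

lemma emeasure_leb01_sq_le:
  assumes [measurable]: "A \<in> sets leb01_sq"
  shows "emeasure leb01_sq A \<le> emeasure romik_ext_measure A"
proof -
  have "emeasure leb01_sq A = (\<integral>\<^sup>+z. indicator A z \<partial>leb01_sq)" by simp
  also have "\<dots> \<le> (\<integral>\<^sup>+z. ennreal (romik_kernel (fst z) (snd z)) * indicator A z \<partial>leb01_sq)"
    using AE_irrational_square
    by (intro nn_integral_mono_AE) (auto elim!: eventually_mono split: split_indicator dest: romik_kernel_ge_1)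
  finally show ?thesis by (simp add: emeasure_romik_ext_measure)
qed

text \<open>Inner regularity by compact sets; the invariant measure is infinite, but its restriction to the core
is finite.\<close>

lemma romik_core_inner_regular:
  fixes e :: real
  assumes A: "A \<in> sets leb01_sq" "A \<subseteq> romik_core" and "e > 0"
  obtains K where "compact K" "K \<subseteq> A" "emeasure romik_ext_measure (A - K) < ennreal e"
proof -
  let ?M = romik_ext_measure
  have idm: "id \<in> measurable ?M borel"
    by (auto intro!: measurableI simp: sets_romik_ext_measure sets_leb01_sq_iff space_romik_ext_measure)
       (metis Int_commute borel_closed closed_Times closed_real_atLeastAtMost sets.Int)
  define m where "m = distr (density ?M (indicator romik_core)) borel id"
  have m: "emeasure m B = emeasure ?M (romik_core \<inter> B)" if "B \<in> sets borel" for B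
  proof -
    have B: "B \<inter> space ?M \<in> sets ?M" using measurable_sets[OF idm that] by simp
    have "emeasure m B = emeasure (density ?M (indicator romik_core)) (B \<inter> space ?M)"
      unfolding m_def using idm that by (subst emeasure_distr) auto
    also have "\<dots> = (\<integral>\<^sup>+z. indicator (romik_core \<inter> B) z \<partial>?M)"
      using B by (subst emeasure_density) (auto simp: sets_romik_ext_measure intro!: nn_integral_cong split: split_indicator)
    also have "\<dots> = emeasure ?M (romik_core \<inter> B)"
    proof (rule nn_integral_indicator)
      have "romik_core \<inter> (B \<inter> space ?M) \<in> sets ?M" using B romik_core_sets
        by (auto simp: sets_romik_ext_measure)
      also have "romik_core \<inter> (B \<inter> space ?M) = romik_core \<inter> B"
        using romik_core_subset irrational_square_subset by (auto simp: space_romik_ext_measure)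
      finally show "romik_core \<inter> B \<in> sets ?M" .
    qed
    finally show ?thesis .
  qed
  have Ab: "A \<in> sets borel" using A by (simp add: sets_leb01_sq_iff)
  have le: "emeasure ?M (romik_core \<inter> B) \<le> emeasure ?M romik_core" for B
    by (intro emeasure_mono) (auto simp: sets_romik_ext_measure)
  have fin: "emeasure m (space m) \<noteq> \<infinity>"
    using m[of UNIV] emeasure_romik_core_finite by (simp add: m_def)
  have "emeasure m A = (SUP K\<in>{K. K \<subseteq> A \<and> compact K}. emeasure m K)"
    by (rule inner_regular) (use Ab fin in \<open>auto simp: m_def\<close>)
  moreover have "emeasure m A \<noteq> \<infinity>"
    using m[OF Ab] le[of A] emeasure_romik_core_finite by (auto simp: top_unique)
  ultimately have "\<exists>K\<in>{K. K \<subseteq> A \<and> compact K}. emeasure m A < emeasure m K + ennreal e"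
    using \<open>e > 0\<close> by (intro SUP_approx_ennreal) auto
  then obtain K where K: "K \<subseteq> A" "compact K" "emeasure m A < emeasure m K + ennreal e" by blast
  have Kb: "K \<in> sets borel" using K(2) by (rule borel_compact)
  have "K \<subseteq> {0..1} \<times> {0..1}" using K(1) A romik_core_subset irrational_square_subset by blast
  hence Ks: "K \<in> sets leb01_sq" using Kb by (simp add: sets_leb01_sq_iff)
  have eqA: "emeasure m A = emeasure ?M A" "emeasure m K = emeasure ?M K"
    using m[OF Ab] m[OF Kb] A K(1) by (simp_all add: Int_absorb1 Int_absorb2 subset_trans)
  have "emeasure ?M A = emeasure ?M K + emeasure ?M (A - K)"
    using K(1) A Ks by (subst plus_emeasure) (auto simp: sets_romik_ext_measure Un_absorb1)
  hence "emeasure ?M K + emeasure ?M (A - K) < emeasure ?M K + ennreal e"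
    using K(3) eqA by simp
  hence "emeasure ?M (A - K) < ennreal e"
    by (simp add: ennreal_add_left_cancel_less)
  with K show thesis by (intro that)
qed

text \<open>Hopf's argument along the contracted vertical fibres. The integral of \<open>f\<close> is shown to be at most \<open>e\<close>
for every \<open>e > 0\<close>.\<close>

lemma core_columns_dichotomy:
  assumes D: "D \<in> sets leb01_sq" and inv: "romik_invariant D"
  shows "AE x in leb01. emeasure leb01 (Pair x -` (romik_core \<inter> D)) = 0 \<or>
    emeasure leb01 (Pair x -` (romik_core - D)) = 0"
proof -
  let ?M = romik_ext_measure and ?E = romik_core
  note [measurable] = D
  define f where "f x = min (emeasure leb01 (Pair x -` (?E \<inter> D))) (emeasure leb01 (Pair x -` (?E - D)))" for x
  have sets1: "?E \<inter> D \<in> sets (leb01 \<Otimes>\<^sub>M leb01)" "?E - D \<in> sets (leb01 \<Otimes>\<^sub>M leb01)"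
    using D romik_core_sets by (auto simp: leb01_sq_def)
  have [measurable]: "f \<in> borel_measurable leb01"
    unfolding f_def using sets1 by (intro borel_measurable_min leb01.measurable_emeasure_Pair)
  have "(\<integral>\<^sup>+x. f x \<partial>leb01) \<le> ennreal e" if "e > 0" for e
  proof -
    have e: "e/2 > 0" using that by simp
    obtain K where K: "compact K" "K \<subseteq> ?E \<inter> D" "emeasure ?M (?E \<inter> D - K) < ennreal (e/2)"
      by (rule romik_core_inner_regular[OF _ _ e, of "?E \<inter> D"]) auto
    obtain K' where K': "compact K'" "K' \<subseteq> ?E - D" "emeasure ?M (?E - D - K') < ennreal (e/2)"
      by (rule romik_core_inner_regular[OF _ _ e, of "?E - D"]) auto
    have Ks: "K \<in> sets leb01_sq" "K' \<in> sets leb01_sq"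
      using K K' romik_core_subset irrational_square_subset borel_compact
      by (auto simp: sets_leb01_sq_iff)
    obtain d where d: "d > 0" "\<And>z z'. z \<in> K \<Longrightarrow> z' \<in> K' \<Longrightarrow> d \<le> dist z z'"
      using separate_compact_closed[OF K(1) compact_imp_closed[OF K'(1)]] K(2) K'(2) by blast
    obtain n where n: "(4/9::real) ^ n < d"
      using real_arch_pow_inv[OF d(1), of "4/9"] by auto
    \<comment> \<open>Outside \<open>Bn\<close>, the \<open>n\<close>-th return of a core point lies in \<open>K\<close> or in \<open>K'\<close>.\<close>
    define B where "B = (?E \<inter> D - K) \<union> (?E - D - K')"
    define Bn where "Bn = {z\<in>?E. (core_return ^^ n) z \<in> B}"
    have B: "B \<in> sets ?M" "B \<subseteq> ?E"
      using Ks by (auto simp: B_def sets_romik_ext_measure)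
    have Bn: "Bn \<in> sets ?M" "emeasure ?M Bn \<le> emeasure ?M B"
      using first_return_map_funpow_vimage[OF measure_preserving_romik_ext _ B core_return_ex, of n]
      by (auto simp: Bn_def sets_romik_ext_measure)
    have BnQ: "Bn \<in> sets leb01_sq" "Bn \<in> sets (leb01 \<Otimes>\<^sub>M leb01)"
      using Bn by (auto simp: sets_romik_ext_measure leb01_sq_def)
    have fle: "f x \<le> emeasure leb01 (Pair x -` Bn)" for x
    \<comment> \<open>Two points of the column that are separated by \<open>D\<close> cannot both be outside \<open>Bn\<close>: their returns in
      \<open>K\<close> and \<open>K'\<close> would be closer than \<open>d\<close>. So \<open>Bn\<close> contains one of the two parts of the column.\<close>
    proof (cases "Pair x -` (?E \<inter> D) \<subseteq> Pair x -` Bn")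
      case True
      hence "emeasure leb01 (Pair x -` (?E \<inter> D)) \<le> emeasure leb01 (Pair x -` Bn)"
        using BnQ by (intro emeasure_mono sets_Pair1) auto
      thus ?thesis by (auto simp: f_def min_le_iff_disj)
    next
      case False
      then obtain y where y: "(x, y) \<in> ?E" "(x, y) \<in> D" "(x, y) \<notin> Bn" by auto
      hence yK: "(core_return ^^ n) (x, y) \<in> K"
        using funpow_core_return_mem[OF y(1)] romik_invariant_core_return[OF inv y(1)]
        by (auto simp: Bn_def B_def)
      have "Pair x -` (?E - D) \<subseteq> Pair x -` Bn"
      proof
        fix y' assume "y' \<in> Pair x -` (?E - D)"
        hence y': "(x, y') \<in> ?E" "(x, y') \<notin> D" by auto
        have "(core_return ^^ n) (x, y') \<notin> K'"
          using d(2)[OF yK, of "(core_return ^^ n) (x, y')"] dist_funpow_core_return[OF y(1) y'(1), of n] n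
          by auto
        thus "y' \<in> Pair x -` Bn"
          using y' funpow_core_return_mem[OF y'(1)] romik_invariant_core_return[OF inv y'(1)]
          by (auto simp: Bn_def B_def)
      qed
      hence "emeasure leb01 (Pair x -` (?E - D)) \<le> emeasure leb01 (Pair x -` Bn)"
        using BnQ by (intro emeasure_mono sets_Pair1) auto
      thus ?thesis by (auto simp: f_def min_le_iff_disj)
    qed
    have "(\<integral>\<^sup>+x. f x \<partial>leb01) \<le> (\<integral>\<^sup>+x. emeasure leb01 (Pair x -` Bn) \<partial>leb01)"
      by (intro nn_integral_mono fle)
    also have "\<dots> = emeasure leb01_sq Bn"
      unfolding leb01_sq_def using BnQ(2) by (rule leb01.emeasure_pair_measure_alt[symmetric])
    also have "\<dots> \<le> emeasure ?M Bn" by (rule emeasure_leb01_sq_le[OF BnQ(1)])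
    also have "\<dots> \<le> emeasure ?M B" by (rule Bn)
    also have "\<dots> \<le> emeasure ?M (?E \<inter> D - K) + emeasure ?M (?E - D - K')"
      unfolding B_def using Ks by (intro emeasure_subadditive) (auto simp: sets_romik_ext_measure)
    also have "\<dots> \<le> ennreal (e/2) + ennreal (e/2)"
      using K(3) K'(3) by (intro add_mono) auto
    also have "\<dots> = ennreal e" using that by (simp flip: ennreal_plus)
    finally show ?thesis .
  qed
  hence "(\<integral>\<^sup>+x. f x \<partial>leb01) \<le> 0 + ennreal e" if "e > 0" for e
    using that by simp
  hence "(\<integral>\<^sup>+x. f x \<partial>leb01) \<le> 0"
    by (rule ennreal_le_epsilon)
  hence "AE x in leb01. f x = 0"
    by (simp add: nn_integral_0_iff_AE)
  thus ?thesis
    by eventually_elim (auto simp: f_def min_def split: if_splits)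
qed

lemma core_rows_dichotomy:
  assumes D: "D \<in> sets leb01_sq" and inv: "romik_invariant D"
  shows "AE y in leb01. emeasure leb01 ((\<lambda>x. (x, y)) -` (romik_core \<inter> D)) = 0 \<or>
    emeasure leb01 ((\<lambda>x. (x, y)) -` (romik_core - D)) = 0"
proof -
  let ?D = "prod.swap -` D \<inter> {0..1} \<times> {0..1}"
  have D': "?D \<in> sets leb01_sq"
    using measurable_sets[OF measurable_swap D] by simp
  have core: "(x, y) \<in> romik_core \<longleftrightarrow> (y, x) \<in> romik_core" for x y
    by (auto simp: romik_core_def)
  have "romik_core \<inter> ?D = romik_core \<inter> prod.swap -` D" "romik_core - ?D = romik_core - prod.swap -` D"
    using romik_core_subset irrational_square_subset by blast+
  hence "Pair y -` (romik_core \<inter> ?D) = (\<lambda>x. (x, y)) -` (romik_core \<inter> D)"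
    "Pair y -` (romik_core - ?D) = (\<lambda>x. (x, y)) -` (romik_core - D)" for y
    by (auto simp: core[of _ y])
  with core_columns_dichotomy[OF D' romik_invariant_Int_space[OF romik_invariant_swap[OF inv]]]
  show ?thesis by simp
qed

text \<open>The columns of the core over \<open>[1/3, 1/2]\<close> are full, so a set \<open>X\<close> of such columns lying in \<open>D\<close> meets
almost every row of the core in a set of positive measure; then the dichotomy for rows puts almost
every row into \<open>D\<close>.\<close>

lemma core_full_if_full_columns:
  assumes D: "D \<in> sets leb01_sq" and inv: "romik_invariant D"
    and X: "X \<in> sets leb01" "X \<subseteq> {1/3..1/2}" "emeasure leb01 X \<noteq> 0"
    and full: "\<And>x. x \<in> X \<Longrightarrow> emeasure leb01 (Pair x -` (romik_core - D)) = 0"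
  shows "emeasure leb01_sq (romik_core - D) = 0"
proof -
  note [measurable] = D X(1)
  have core_D: "romik_core - D \<in> sets (leb01 \<Otimes>\<^sub>M leb01)"
    and core_Int_D: "romik_core \<inter> D \<in> sets (leb01 \<Otimes>\<^sub>M leb01)"
    using D romik_core_sets by (auto simp: leb01_sq_def)
  have Xb: "X \<in> sets borel" using X by (simp add: sets_leb01_iff)
  define W where "W = {z \<in> space leb01_sq. z \<in> romik_core - D \<and> fst z \<in> X}"
  have W: "W \<in> sets leb01_sq"
  proof -
    note [measurable] = Xb
    show ?thesis unfolding W_def by measurable
  qed
  hence W': "W \<in> sets (leb01 \<Otimes>\<^sub>M leb01)" by (simp add: leb01_sq_def)
  have "emeasure (leb01 \<Otimes>\<^sub>M leb01) W = (\<integral>\<^sup>+x. emeasure leb01 (Pair x -` W) \<partial>leb01)"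
    using W' by (rule leb01.emeasure_pair_measure_alt)
  also have "\<dots> = (\<integral>\<^sup>+x. 0 \<partial>leb01)"
  proof (rule nn_integral_cong)
    fix x
    show "emeasure leb01 (Pair x -` W) = 0"
    proof (cases "x \<in> X")
      case True
      have "emeasure leb01 (Pair x -` W) \<le> emeasure leb01 (Pair x -` (romik_core - D))"
        by (intro emeasure_mono sets_Pair1[OF core_D]) (auto simp: W_def)
      thus ?thesis using full[OF True] by simp
    next
      case False
      hence "Pair x -` W = {}" by (auto simp: W_def)
      thus ?thesis by simp
    qed
  qed
  finally have "(\<integral>\<^sup>+y. emeasure leb01 ((\<lambda>x. (x, y)) -` W) \<partial>leb01) = 0"
    using leb01_pair.emeasure_pair_measure_alt2[OF W'] by simp
  hence rows: "AE y in leb01. emeasure leb01 ((\<lambda>x. (x, y)) -` W) = 0"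
    using leb01_pair.measurable_emeasure_Pair2[OF W'] by (simp add: nn_integral_0_iff_AE)
  have "AE y in leb01. emeasure leb01 ((\<lambda>x. (x, y)) -` (romik_core - D)) = 0"
    using rows core_rows_dichotomy[OF D inv] AE_leb01_irrational AE_space
  proof eventually_elim
    case (elim y)
    have y: "0 < y" "y < 1" "y \<notin> \<rat>"
    proof -
      have "y \<noteq> 0" "y \<noteq> 1" using elim by auto
      thus "0 < y" "y < 1" "y \<notin> \<rat>" using elim by auto
    qed
    have Dn: "emeasure leb01 ((\<lambda>x. (x, y)) -` (romik_core \<inter> D)) \<noteq> 0"
    proof
      assume 0: "emeasure leb01 ((\<lambda>x. (x, y)) -` (romik_core \<inter> D)) = 0"
      have s1: "(\<lambda>x. (x, y)) -` (romik_core \<inter> D) \<in> sets leb01"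
        by (rule sets_Pair2[OF core_Int_D])
      have s2: "(\<lambda>x. (x, y)) -` W \<in> sets leb01"
        using W' by (rule sets_Pair2)
      have "AE x in leb01. x \<notin> (\<lambda>x. (x, y)) -` (romik_core \<inter> D)"
        using 0 s1 by (intro AE_not_in) auto
      moreover have "AE x in leb01. x \<notin> (\<lambda>x. (x, y)) -` W"
        using elim s2 by (intro AE_not_in) auto
      ultimately have "AE x in leb01. x \<notin> X"
        using AE_leb01_irrational
      proof eventually_elim
        case (elim x)
        show ?case
        proof
          assume x: "x \<in> X"
          hence "x \<in> {1/3..1/2}" using X(2) by auto
          hence "(x, y) \<in> romik_core"
            using elim y by (auto simp: romik_core_def)
          thus False using elim x X(2) y by (auto simp: W_def)
        qed
      qed
      hence "emeasure leb01 X = 0"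
        using X(1) by (simp add: AE_iff_null_sets[symmetric] null_setsD1)
      thus False using X(3) by simp
    qed
    thus ?case using elim by auto
  qed
  hence "(\<integral>\<^sup>+y. emeasure leb01 ((\<lambda>x. (x, y)) -` (romik_core - D)) \<partial>leb01) = (\<integral>\<^sup>+y. 0 \<partial>leb01)"
    by (intro nn_integral_cong_AE) simp
  thus ?thesis
    unfolding leb01_sq_def by (simp add: leb01_pair.emeasure_pair_measure_alt2[OF core_D])
qed

lemma core_dichotomy:
  assumes D: "D \<in> sets leb01_sq" and inv: "romik_invariant D"
  shows "emeasure leb01_sq (romik_core \<inter> D) = 0 \<or> emeasure leb01_sq (romik_core - D) = 0"
proof -
  let ?D' = "{0..1} \<times> {0..1} - D"
  have D': "?D' \<in> sets leb01_sq" using D sets.compl_sets[OF D] by simp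
  have sets1: "romik_core \<inter> D \<in> sets (leb01 \<Otimes>\<^sub>M leb01)" "romik_core - D \<in> sets (leb01 \<Otimes>\<^sub>M leb01)"
    using D romik_core_sets by (auto simp: leb01_sq_def)
  note [measurable] = leb01.measurable_emeasure_Pair[OF sets1(1)] leb01.measurable_emeasure_Pair[OF sets1(2)]
  define I where "I = {1/3..1/2::real}"
  have [measurable]: "I \<in> sets leb01" by (auto simp: I_def sets_leb01_iff)
  define X where "X = {x \<in> space leb01. x \<in> I \<and> emeasure leb01 (Pair x -` (romik_core - D)) = 0}"
  define Y where "Y = {x \<in> space leb01. x \<in> I \<and> emeasure leb01 (Pair x -` (romik_core \<inter> D)) = 0}"
  have XY: "X \<in> sets leb01" "Y \<in> sets leb01"
    unfolding X_def Y_def by measurable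
  have "\<not> (emeasure leb01 X = 0 \<and> emeasure leb01 Y = 0)"
  proof
    assume "emeasure leb01 X = 0 \<and> emeasure leb01 Y = 0"
    hence "AE x in leb01. x \<notin> X" "AE x in leb01. x \<notin> Y"
      using XY by (auto intro!: AE_not_in)
    hence "AE x in leb01. x \<notin> I"
      using core_columns_dichotomy[OF D inv] AE_space
      by eventually_elim (auto simp: X_def Y_def)
    hence "emeasure leb01 I = 0"
      by (simp add: AE_iff_null_sets[symmetric] null_setsD1)
    moreover have "emeasure leb01 I = ennreal (1/6)"
      by (simp add: I_def emeasure_leb01)
    ultimately show False by simp
  qed
  hence "emeasure leb01 X \<noteq> 0 \<or> emeasure leb01 Y \<noteq> 0" by blast
  thus ?thesis
  proof
    assume "emeasure leb01 X \<noteq> 0"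
    hence "emeasure leb01_sq (romik_core - D) = 0"
      by (intro core_full_if_full_columns[OF D inv XY(1)]) (auto simp: X_def I_def)
    thus ?thesis ..
  next
    assume "emeasure leb01 Y \<noteq> 0"
    moreover have eq: "romik_core - ?D' = romik_core \<inter> D"
      using romik_core_subset irrational_square_subset by auto
    ultimately have "emeasure leb01_sq (romik_core - ?D') = 0"
      by (intro core_full_if_full_columns[OF D' romik_invariant_Diff_space[OF inv] XY(2)])
         (auto simp only: Y_def I_def eq)
    thus ?thesis using eq by simp
  qed
qed

text \<open>Every irrational orbit visits the core, so an invariant set is determined by its part in the core.\<close>

lemma romik_ext_full_if_core_full:
  assumes D: "D \<in> sets leb01_sq" and inv: "romik_invariant D"
    and full: "emeasure leb01_sq (romik_core - D) = 0"
  shows "AE z in romik_ext_measure. z \<in> D"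
proof -
  have "romik_core - D \<in> null_sets leb01_sq"
    using full D romik_core_sets by auto
  hence "romik_core - D \<in> null_sets romik_ext_measure"
    using absolutely_continuous_romik_ext_measure by (auto simp: absolutely_continuous_def)
  hence 0: "AE z in romik_ext_measure. z \<in> romik_core \<longrightarrow> z \<in> D"
    by (auto dest: AE_not_in)
  have "AE z in romik_ext_measure. (romik_ext ^^ k) z \<in> romik_core \<longrightarrow> (romik_ext ^^ k) z \<in> D" for k
  proof (induction k)
    case (Suc k)
    from AE_measure_preserving[OF measure_preserving_romik_ext this]
    show ?case by (simp add: funpow_Suc_right del: funpow.simps(2) romik_ext.simps)
  qed (use 0 in simp)
  hence "AE z in romik_ext_measure. \<forall>k. (romik_ext ^^ k) z \<in> romik_core \<longrightarrow> (romik_ext ^^ k) z \<in> D"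
    by (simp add: AE_all_countable)
  moreover have "AE z in romik_ext_measure. z \<in> irrational_square"
    by (rule AE_romik_ext_measure_irrational_square)
  ultimately show ?thesis
  proof eventually_elim
    case (elim z)
    obtain k where "(romik_ext ^^ k) z \<in> romik_core"
      using enters_romik_core[OF elim(2)] ..
    thus ?case using elim romik_invariant_funpow[OF inv elim(2)] by blast
  qed
qed

lemma ergodic_romik_ext: "ergodic romik_ext_measure romik_ext"
  unfolding ergodic_def
proof (intro ballI impI)
  let ?M = romik_ext_measure
  fix D assume "D \<in> sets ?M" and inv: "romik_ext -` D \<inter> space ?M = D"
  hence D: "D \<in> sets leb01_sq" by (simp add: sets_romik_ext_measure)
  have inv': "romik_invariant D"
    unfolding romik_invariant_def using inv irrational_square_subset
    by (auto simp: space_romik_ext_measure simp del: romik_ext.simps)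
  let ?D' = "{0..1} \<times> {0..1} - D"
  have D': "?D' \<in> sets leb01_sq" using sets.compl_sets[OF D] by simp
  from core_dichotomy[OF D inv'] show "emeasure ?M D = 0 \<or> emeasure ?M (space ?M - D) = 0"
  proof
    assume "emeasure leb01_sq (romik_core \<inter> D) = 0"
    moreover have "romik_core - ?D' = romik_core \<inter> D"
      using romik_core_subset irrational_square_subset by auto
    ultimately have "AE z in ?M. z \<in> ?D'"
      by (intro romik_ext_full_if_core_full[OF D' romik_invariant_Diff_space[OF inv']]) simp
    hence "AE z in ?M. z \<notin> D" by eventually_elim auto
    thus ?thesis using D
      by (simp add: AE_iff_null_sets[symmetric] null_setsD1 sets_romik_ext_measure)
  next
    assume "emeasure leb01_sq (romik_core - D) = 0"
    hence "AE z in ?M. z \<in> D" by (rule romik_ext_full_if_core_full[OF D inv'])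
    hence "AE z in ?M. z \<notin> ?D'" by eventually_elim auto
    hence "?D' \<in> null_sets ?M"
      using D' by (subst AE_iff_null_sets) (simp_all only: sets_romik_ext_measure)
    thus ?thesis by (simp add: null_setsD1 space_romik_ext_measure)
  qed
qed


section \<open>Uniqueness of the absolutely continuous invariant measure\<close>

text \<open>Both \<open>h\<close> and its composition with the map are densities of the same measure: substitute by the
invariance of the reference measure, with preimages under the inverse in place of images.\<close>

lemma density_romik_ext_invariant:
  assumes h[measurable]: "h \<in> borel_measurable romik_ext_measure"
    and inv: "measure_preserving (density romik_ext_measure h) (density romik_ext_measure h) romik_ext"
  shows "AE z in romik_ext_measure. h (romik_ext z) = h z"
proof -
  let ?M = romik_ext_measure and ?T = romik_ext and ?S = romik_ext_inv
  let ?N = "density ?M h"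
  interpret sigma_finite_measure ?M by (rule sigma_finite_romik_ext_measure)
  have irr: "AE z in ?M. z \<in> irrational_square"
    by (rule AE_romik_ext_measure_irrational_square)
  hence irrN: "AE z in ?N. z \<in> irrational_square"
    by (auto simp: AE_density elim: eventually_mono)
  have T: "?T \<in> measurable ?M ?M" and S: "?S \<in> measurable ?M ?M"
    by measurable
  have "density ?M (\<lambda>z. h (?T z)) = density ?M h"
  proof (rule measure_eqI)
    fix B assume "B \<in> sets (density ?M (\<lambda>z. h (?T z)))"
    hence B: "B \<in> sets ?M" by simp
    have SB: "?S -` B \<inter> space ?M \<in> sets ?M" using S B by (rule measurable_sets)
    have TSB: "?T -` (?S -` B \<inter> space ?M) \<inter> space ?M \<in> sets ?M" using T SB by (rule measurable_sets)
    have dT: "distr ?M ?M ?T = ?M"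
      using measure_preservingD(2)[OF measure_preserving_romik_ext] T
      by (intro measure_eqI) (simp_all add: emeasure_distr)
    have hT: "(\<lambda>z. h (?T z)) \<in> borel_measurable ?M" using T h by (rule measurable_compose)
    have "emeasure (density ?M (\<lambda>z. h (?T z))) B = (\<integral>\<^sup>+z. h (?T z) * indicator B z \<partial>?M)"
      using B hT by (simp add: emeasure_density)
    also have "\<dots> = (\<integral>\<^sup>+z. h (?T z) * indicator (?S -` B \<inter> space ?M) (?T z) \<partial>?M)"
    proof (rule nn_integral_cong_AE)
      show "AE z in ?M. h (?T z) * indicator B z = h (?T z) * indicator (?S -` B \<inter> space ?M) (?T z)"
        using irr AE_space
      proof eventually_elim
        case (elim z)
        hence "?T z \<in> ?S -` B \<inter> space ?M \<longleftrightarrow> z \<in> B"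
          using measurable_space[OF T] by simp
        thus ?case by (simp only: indicator_def)
      qed
    qed
    also have "\<dots> = (\<integral>\<^sup>+w. h w * indicator (?S -` B \<inter> space ?M) w \<partial>distr ?M ?M ?T)"
      using T SB by (subst nn_integral_distr) auto
    also have "\<dots> = emeasure ?N (?S -` B \<inter> space ?M)"
      using SB by (simp add: dT emeasure_density)
    also have "\<dots> = emeasure ?N (?T -` (?S -` B \<inter> space ?M) \<inter> space ?M)"
      using measure_preservingD(2)[OF inv, of "?S -` B \<inter> space ?M"] SB by simp
    also have "\<dots> = emeasure ?N B"
    proof (rule emeasure_eq_AE)
      show "AE z in ?N. z \<in> ?T -` (?S -` B \<inter> space ?M) \<inter> space ?M \<longleftrightarrow> z \<in> B"
        using irrN AE_space
      proof eventually_elim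
        case (elim z)
        thus ?case using measurable_space[OF T] by (simp del: romik_ext.simps)
      qed
    qed (use B TSB in simp_all)
    finally show "emeasure (density ?M (\<lambda>z. h (?T z))) B = emeasure ?N B" .
  qed simp
  thus ?thesis
    using T h by (intro density_unique) (auto intro: measurable_compose)
qed

lemma is_the_acim_romik_ext: "is_the_acim leb01_sq romik_ext romik_ext_measure"
  unfolding is_the_acim_def
proof (intro conjI allI impI)
  let ?M = romik_ext_measure
  interpret sigma_finite_measure ?M by (rule sigma_finite_romik_ext_measure)
  show "sets ?M = sets leb01_sq" by (rule sets_romik_ext_measure)
  show "absolutely_continuous leb01_sq ?M" by (rule absolutely_continuous_romik_ext_measure)
  show "measure_preserving_system ?M romik_ext" by (rule measure_preserving_system_romik_ext)
  fix \<nu> :: "(real \<times> real) measure"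
  assume \<nu>: "sets \<nu> = sets leb01_sq \<and> absolutely_continuous leb01_sq \<nu> \<and> measure_preserving_system \<nu> romik_ext"
  \<comment> \<open>The kernel is at least \<open>1\<close> almost everywhere, so the invariant and the Lebesgue null sets coincide.\<close>
  have "null_sets ?M \<subseteq> null_sets leb01_sq"
    using emeasure_leb01_sq_le by (auto simp: null_sets_def sets_romik_ext_measure) (metis le_zero_eq)
  hence "absolutely_continuous ?M \<nu>"
    using \<nu> by (auto simp: absolutely_continuous_def)
  then obtain h where h: "h \<in> borel_measurable ?M" "density ?M h = \<nu>"
    using Radon_Nikodym[of \<nu>] \<nu> by (auto simp: sets_romik_ext_measure)
  have "AE z in ?M. h (romik_ext z) = h z"
    using \<nu> h by (intro density_romik_ext_invariant) (auto simp: measure_preserving_system_def)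
  then obtain c where c: "AE z in ?M. h z = c"
    using ergodic_invariant_function_constant[OF measure_preserving_romik_ext ergodic_romik_ext h(1)] by blast
  have "AE z in ?M. h z \<noteq> \<infinity>"
    using \<nu> h sigma_finite_iff_density_finite[OF h(1)] by (auto simp: measure_preserving_system_def)
  with c have c': "AE z in ?M. h z = ennreal (enn2real c)"
    by eventually_elim (simp add: less_top)
  have "\<nu> = density ?M (\<lambda>_. ennreal (enn2real c))"
    unfolding h(2)[symmetric] using h(1) c' by (intro density_cong) auto
  also have "\<dots> = scale_measure (ennreal (enn2real c)) ?M"
    by (intro measure_eqI) (simp_all add: emeasure_density_const)
  finally show "\<exists>c::real. c \<ge> 0 \<and> \<nu> = scale_measure (ennreal c) ?M"
    by (intro exI[of _ "enn2real c"]) simp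
qed

theorem proposition2p5:
  "romik_ext \<in> {0..1} \<times> {0..1} \<rightarrow> {0..1} \<times> {0..1} \<and>
   ae_bijective leb01_sq romik_ext \<and>
   is_the_acim leb01_sq romik_ext romik_ext_measure \<and>
   ergodic romik_ext_measure romik_ext \<and>
   natural_extension_via romik_ext_measure romik_ext romik_measure romik fst"
  using romik_ext_unit_square ae_bijective_romik_ext is_the_acim_romik_ext ergodic_romik_ext
    natural_extension_romik
  by blast

end
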